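(* Let $m\ge1$ be a fixed integer and $G\sim\mathcal{PA}(m;n)$. For any $\gamma=\gamma(n)>0$, there exists $\ell=\ell(\gamma)$ for which the number of vertices that are not in the first $\ell$ layers of $\mathrm{DAG}(G)$ is at most $\gamma n$, with high probability. In particular, we can take $\ell \ge 12Cm/\gamma^4$, where $C>0$ is a constant such that, for all $w<v$, the probability that $v$ is adjacent to $w$ in the preferential attachment graph is at most $Cm/\sqrt{vw}$.
   Context: Preferential attachment model: for an integer $m\ge 1$, $\mathcal{PA}(m;n)$ is the distribution of the random multigraph $G_n$ on vertex set $[n]=\{1,\dots,n\}$ built recursively as follows. $G_1$ is the single vertex $1$ with $m$ self-loops (these are the only self-loops in the graph, and each is counted once in the degree of vertex $1$). Given $G_n$, add vertex $n+1$ and let it make $m$ random choices $v_1,\dots,v_m\in[n]$ of neighbors with $$P(v_i = w \mid G_n, v_1,\dots,v_{i-1}) = \frac{\deg_n(w)}{\sum_{u\in[n]}\deg_n(u)} = \frac{\deg_n(w)}{2mn-m},\qquad w\in[n],$$ where $\deg_n(w)$ is the degree of $w$ in $G_n$ (multiplicities counted); one edge joins $n+1$ to each $v_i$, so multiple edges may occur. The result is $G_{n+1}\sim\mathcal{PA}(m;n+1)$. $\mathrm{DAG}(G)$ is the directed version of $G$ on the same vertex set: each edge of $G$ between $u$ and $v<u$ is directed from $u$ to $v$. Self-loops are ignored, so this is a directed acyclic graph. Its layers (levels) are defined inductively: $L_1$ is the set of vertices with in-degree $0$; $L_j$ is the set of vertices all of whose incoming edges come from $\bigcup_{i=1}^{j-1}L_i$,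 with at least one incoming edge from $L_{j-1}$. The first $\ell$ layers are $L_1,\dots,L_\ell$. "With high probability" means with probability tending to $1$ as $n\to\infty$. *)

theory Defs
  imports "HOL-Probability.Probability" "HOL-Library.Multiset"
begin

section \<open>Multigraphs\<close>

text \<open>
  An edge is represented by its set of endpoints, so a self-loop at \<open>v\<close> is \<open>{v}\<close>.
  Counting the edges that contain \<open>v\<close> therefore counts a self-loop once in the degree of \<open>v\<close>.
\<close>

datatype multigraph = Multigraph (verts: "nat set") (edges: "nat set multiset")

definition adjacent :: "multigraph \<Rightarrow> nat \<Rightarrow> nat \<Rightarrow> bool" where
  "adjacent G v w \<longleftrightarrow> {v, w} \<in># edges G"

definition vdeg :: "multigraph \<Rightarrow> nat \<Rightarrow> nat" where
  "vdeg G v = size {#e \<in># edges G. v \<in> e#}"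


section \<open>The preferential attachment model\<close>

text \<open>
  \<open>embed_pmf\<close> is meaningful only for nonnegative weights of total mass 1; lemma
  \<open>pmf_neighbor_pmf\<close> below shows that this is the case for every graph arising in the model.
\<close>

definition neighbor_pmf :: "multigraph \<Rightarrow> nat pmf" where
  "neighbor_pmf G = embed_pmf (\<lambda>w.
     if w \<in> verts G then real (vdeg G w) / real (\<Sum>u\<in>verts G. vdeg G u) else 0)"

definition attach :: "multigraph \<Rightarrow> nat \<Rightarrow> nat list \<Rightarrow> multigraph" where
  "attach G v ws =
     Multigraph (insert v (verts G)) (edges G + image_mset (\<lambda>w. {v, w}) (mset ws))"

text \<open>
  Each choice is made with the degrees of the old graph, whatever the previous choices were, so
  given the old graph the \<open>m\<close> choices are independent and identically distributed.
  The value at \<open>n = 0\<close> is irrelevant.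
\<close>

fun pref_attach :: "nat \<Rightarrow> nat \<Rightarrow> multigraph pmf" where
  "pref_attach m 0 = return_pmf (Multigraph {} {#})"
| "pref_attach m (Suc 0) = return_pmf (Multigraph {1} (replicate_mset m {1}))"
| "pref_attach m (Suc (Suc n)) =
     do {
       G \<leftarrow> pref_attach m (Suc n);
       ws \<leftarrow> replicate_pmf m (neighbor_pmf G);
       return_pmf (attach G (Suc (Suc n)) ws)
     }"

lemma sum_vdeg:
  assumes "finite (verts G)" "\<And>e. e \<in># edges G \<Longrightarrow> e \<subseteq> verts G"
  shows "(\<Sum>u\<in>verts G. vdeg G u) = (\<Sum>e\<in>#edges G. card e)"
proof -
  have "(\<Sum>u\<in>V. size {#e \<in># E. u \<in> e#}) = (\<Sum>e\<in>#E. card e)"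
    if "finite V" "\<And>e. e \<in># E \<Longrightarrow> e \<subseteq> V" for V :: "nat set" and E
    using that
  proof (induction E)
    case (add e E)
    have "(\<Sum>u\<in>V. size {#x \<in># add_mset e E. u \<in> x#})
        = (\<Sum>u\<in>V. (if u \<in> e then 1 else 0) + size {#x \<in># E. u \<in> x#})"
      by (intro sum.cong) auto
    also have "\<dots> = card (V \<inter> e) + (\<Sum>x\<in>#E. card x)"
      using add by (simp add: sum.distrib sum.If_cases)
    also have "V \<inter> e = e" using add.prems by auto
    finally show ?case by simp
  qed simp
  from this[of "verts G" "edges G"] assms show ?thesis by (simp add: vdeg_def)
qed

lemma pmf_neighbor_pmf_aux:
  assumes "finite (verts G)" "(\<Sum>u\<in>verts G. vdeg G u) > 0"
  shows "pmf (neighbor_pmf G) w =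
    (if w \<in> verts G then real (vdeg G w) / real (\<Sum>u\<in>verts G. vdeg G u) else 0)"
  unfolding neighbor_pmf_def
proof (rule pmf_embed_pmf)
  let ?f = "\<lambda>w. if w \<in> verts G then real (vdeg G w) / real (\<Sum>u\<in>verts G. vdeg G u) else 0"
  show nonneg: "0 \<le> ?f x" for x by (simp add: sum_nonneg)
  have "(\<integral>\<^sup>+ x. ennreal (?f x) \<partial>count_space UNIV)
      = (\<integral>\<^sup>+ x. ennreal (?f x) \<partial>count_space (verts G))"
    by (subst nn_integral_count_space_indicator)
       (auto intro!: nn_integral_cong split: split_indicator)
  also have "\<dots> = (\<Sum>x\<in>verts G. ennreal (?f x))"
    using assms by (simp add: nn_integral_count_space_finite)
  also have "\<dots> = ennreal (\<Sum>x\<in>verts G. ?f x)"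
    by (intro sum_ennreal nonneg)
  also have "(\<Sum>x\<in>verts G. ?f x) = 1"
    using assms(2) by (simp flip: sum_divide_distrib of_nat_sum)
  finally show "(\<integral>\<^sup>+ x. ennreal (?f x) \<partial>count_space UNIV) = 1" by simp
qed

lemma pref_attach_invariant:
  assumes "m \<ge> 1" "n \<ge> 1" "G \<in> set_pmf (pref_attach m n)"
  shows "verts G = {1..n}" "\<And>e. e \<in># edges G \<Longrightarrow> e \<subseteq> {1..n}"
    "(\<Sum>u\<in>verts G. vdeg G u) = 2 * m * n - m"
proof -
  have "verts G = {1..n} \<and> (\<forall>e\<in>#edges G. e \<subseteq> {1..n}) \<and>
        (\<Sum>u\<in>verts G. vdeg G u) = 2 * m * n - m"
    using assms(2,3)
  proof (induction n arbitrary: G rule: dec_induct)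
    case base
    then have G: "G = Multigraph {1} (replicate_mset m {1})" by simp
    have "filter_mset (\<lambda>e. Suc 0 \<in> e) (replicate_mset m {Suc 0}) = replicate_mset m {Suc 0}"
      by (intro filter_mset_eq_conv[THEN iffD2]) auto
    then show ?case using assms(1) by (auto simp: G vdeg_def split: if_splits)
  next
    case (step n)
    obtain k where k: "n = Suc k" using step.hyps by (cases n) auto
    from step.prems obtain H ws where H: "H \<in> set_pmf (pref_attach m n)"
      and ws: "ws \<in> set_pmf (replicate_pmf m (neighbor_pmf H))"
      and G: "G = attach H (Suc n) ws"
      unfolding k by auto
    note IH = step.IH[OF H]
    have eq: "(\<Sum>u\<in>verts H. vdeg H u) = 2 * m * n - m" using IH by blast
    have pos: "(\<Sum>u\<in>verts H. vdeg H u) > 0" unfolding eq using assms(1) k by simp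
    have ws': "set ws \<subseteq> {1..n}" "length ws = m"
    proof -
      have "set_pmf (neighbor_pmf H) \<subseteq> {1..n}"
        using pmf_neighbor_pmf_aux[OF _ pos] IH by (auto simp: set_pmf_iff split: if_splits)
      then show "set ws \<subseteq> {1..n}" "length ws = m"
        using ws by (auto simp: set_replicate_pmf lists_def)
    qed
    have V: "verts G = {1..Suc n}" using IH by (auto simp: G attach_def)
    have E: "e \<subseteq> {1..Suc n}" if "e \<in># edges G" for e
      using that IH ws' by (fastforce simp: G attach_def)
    have "(\<Sum>u\<in>verts G. vdeg G u) = (\<Sum>e\<in>#edges G. card e)"
      using V E by (intro sum_vdeg) auto
    also have "\<dots> = (\<Sum>e\<in>#edges H. card e) + (\<Sum>w\<in>#mset ws. card {Suc n, w})"
      by (simp add: G attach_def multiset.map_comp o_def)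
    also have "(\<Sum>e\<in>#edges H. card e) = 2 * m * n - m"
      using sum_vdeg[of H] IH eq by (metis finite_atLeastAtMost)
    also have "(\<Sum>w\<in>#mset ws. card {Suc n, w}) = (\<Sum>w\<in>#mset ws. 2)"
      using ws' by (intro arg_cong[of _ _ sum_mset] image_mset_cong) (auto simp: card_insert_if)
    also have "\<dots> = 2 * m" using ws' by simp
    finally show ?case using V E k by (simp add: algebra_simps)
  qed
  then show "verts G = {1..n}" "\<And>e. e \<in># edges G \<Longrightarrow> e \<subseteq> {1..n}"
    "(\<Sum>u\<in>verts G. vdeg G u) = 2 * m * n - m" by auto
qed

lemma pmf_neighbor_pmf:
  assumes "m \<ge> 1" "n \<ge> 1" "G \<in> set_pmf (pref_attach m n)"
  shows "pmf (neighbor_pmf G) w =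
    (if w \<in> {1..n} then real (vdeg G w) / (2 * real m * real n - real m) else 0)"
proof -
  have "m \<le> 2 * m * n" "m < 2 * m * n" using assms(1,2) by (auto simp: not_less_eq_eq)
  then show ?thesis
    using pref_attach_invariant[OF assms] pmf_neighbor_pmf_aux[of G w]
    by (simp add: of_nat_diff)
qed


section \<open>The directed acyclic graph and its layers\<close>

text \<open>The pair \<open>(u, v)\<close> is an arc from \<open>u\<close> to \<open>v\<close>.\<close>

datatype multidigraph = Multidigraph (dverts: "nat set") (arcs: "(nat \<times> nat) multiset")

definition DAG :: "multigraph \<Rightarrow> multidigraph" where
  "DAG G = Multidigraph (verts G)
     (image_mset (\<lambda>e. (Max e, Min e)) {#e \<in># edges G. card e = 2#})"

definition in_deg :: "multidigraph \<Rightarrow> nat \<Rightarrow> nat" where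
  "in_deg D v = size {#a \<in># arcs D. snd a = v#}"

text \<open>Layers are numbered from 1; there is no layer 0.\<close>

fun layer :: "multidigraph \<Rightarrow> nat \<Rightarrow> nat set" where
  "layer D 0 = {}"
| "layer D (Suc 0) = {v \<in> dverts D. in_deg D v = 0}"
| "layer D (Suc (Suc j)) = {v \<in> dverts D.
     (\<forall>u. (u, v) \<in># arcs D \<longrightarrow> u \<in> (\<Union>i\<in>{1..Suc j}. layer D i)) \<and>
     (\<exists>u. (u, v) \<in># arcs D \<and> u \<in> layer D (Suc j))}"

definition outside_first_layers :: "multigraph \<Rightarrow> nat \<Rightarrow> nat set" where
  "outside_first_layers G l = verts G - (\<Union>j\<in>{1..l}. layer (DAG G) j)"


section \<open>Edge probabilities and the high-probability event\<close>

definition edge_prob_bound :: "nat \<Rightarrow> real \<Rightarrow> bool" where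
  "edge_prob_bound m C \<longleftrightarrow> (\<forall>n v w. 1 \<le> w \<and> w < v \<and> v \<le> n \<longrightarrow>
     measure_pmf.prob (pref_attach m n) {G. adjacent G v w}
       \<le> C * real m / sqrt (real v * real w))"

definition whp :: "(nat \<Rightarrow> multigraph pmf) \<Rightarrow> (nat \<Rightarrow> multigraph \<Rightarrow> bool) \<Rightarrow> bool" where
  "whp M P \<longleftrightarrow> (\<lambda>n. measure_pmf.prob (M n) {G. P n G}) \<longlonglongrightarrow> 1"

end

theory Submission
  imports Defs "HOL-Real_Asymp.Real_Asymp"
begin

text \<open>
  A vertex \<open>v\<close> outside the first \<open>l\<close> layers is the end of a directed path with \<open>l\<close> arcs. Vertices
  on such a path increase backwards from \<open>v\<close>, so if \<open>v > k\<close> the whole path stays above \<open>k\<close>. Fix a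
  threshold \<open>k\<close> of order \<open>\<gamma> n\<close>: the vertices up to \<open>k\<close> are too few to matter, and beyond \<open>k\<close> it
  suffices to bound the number of paths with \<open>l\<close> arcs.

  Give a vertex \<open>v > k\<close> the weight \<open>\<Sum>j\<le>l. 2 ^ j * p j\<close>, where \<open>p j\<close> is the number of paths with \<open>j\<close>
  arcs that start at \<open>v\<close> and stay above \<open>k\<close>. The weight of a vertex is fixed as soon as the vertex
  is created, and a new vertex has weight at most 1 plus twice the weights of the vertices it
  chooses. Since choices are proportional to degrees, the sum \<open>S\<close> of degree times weight satisfies
  a linear recursion in expectation: at time \<open>t\<close> it is multiplied by at most
  \<open>1 + (2 m + 1) / (2 t - 1)\<close> and increased by at most \<open>m\<close>. As that factor is at most
  \<open>(t / (t - 1)) ^ (m + 1)\<close>, the total growth from \<open>k\<close> to \<open>n\<close> is at most \<open>(n / k) ^ (m + 1)\<close>,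
  a power of \<open>1 / \<gamma>\<close>, whereas every vertex above \<open>k\<close> outside the first \<open>l\<close> layers contributes at
  least \<open>m * 2 ^ l\<close> to \<open>S\<close>. After normalisation \<open>S\<close> is a supermartingale (\<open>excess\<close>), with
  increments whose random part is bounded by \<open>m * (2 m + 1) ^ (l + 1)\<close> (\<open>abs_noise_le\<close>).

  Two tail bounds follow. The first moment shows that the graph has no vertex outside its first \<open>l\<close>
  layers, up to probability \<open>n ^ (m + 2) / 2 ^ l\<close> (\<open>prob_deep_vertex_le\<close>). The second moment of
  the positive part shows that at most \<open>\<gamma> n\<close> vertices lie outside the first \<open>l\<close> layers, up to
  probability \<open>(2 m + 1) ^ (2 l + 2) / n\<close>, as soon as \<open>2 ^ l\<close> beats a fixed power of \<open>1 / \<gamma>\<close>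
  (\<open>prob_many_deep_vertices_le\<close>). The former is at most \<open>1 / n\<close> when
  \<open>l \<ge> (m + 3) * log 2 n\<close>. For smaller \<open>l\<close> and \<open>\<gamma> < 1\<close>, the hypothesis \<open>l \<ge> 5 m / \<gamma> ^ 4\<close> forces
  \<open>\<gamma> \<ge> 1 / log 2 n\<close>, and then the first \<open>min l (sqrt (log 2 n))\<close> layers are enough for the latter.

  Finally, \<open>l \<ge> 12 C m / \<gamma> ^ 4\<close> implies \<open>l \<ge> 5 m / \<gamma> ^ 4\<close>, because looking at the edge between two
  consecutive vertices shows that every admissible \<open>C\<close> is at least \<open>5 / 12\<close>. That some \<open>C\<close> is
  admissible follows from the growth rate of the expected degrees.
\<close>

section \<open>Expectations over finitely supported distributions\<close>

lemma expectation_bind_finite: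
  fixes f :: "'b \<Rightarrow> real"
  assumes "finite (set_pmf p)" "\<And>x. x \<in> set_pmf p \<Longrightarrow> finite (set_pmf (q x))"
  shows "measure_pmf.expectation (bind_pmf p q) f
    = measure_pmf.expectation p (\<lambda>x. measure_pmf.expectation (q x) f)"
proof -
  have "measure_pmf.expectation (bind_pmf p q) f
      = (\<Sum>a\<in>set_pmf p. pmf p a *\<^sub>R measure_pmf.expectation (q a) f)"
    by (rule pmf_expectation_bind) (use assms in auto)
  also have "\<dots> = measure_pmf.expectation p (\<lambda>x. measure_pmf.expectation (q x) f)"
    by (rule integral_measure_pmf[symmetric]) (use assms in auto)
  finally show ?thesis .
qed

lemma expectation_mono_finite:
  fixes f g :: "'a \<Rightarrow> real"
  assumes "finite (set_pmf p)" "\<And>x. x \<in> set_pmf p \<Longrightarrow> f x \<le> g x"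
  shows "measure_pmf.expectation p f \<le> measure_pmf.expectation p g"
  by (rule integral_mono_AE)
     (use assms in \<open>auto intro: integrable_measure_pmf_finite simp: AE_measure_pmf_iff\<close>)

lemma expectation_cong:
  fixes f g :: "'a \<Rightarrow> real"
  assumes "\<And>x. x \<in> set_pmf p \<Longrightarrow> f x = g x"
  shows "measure_pmf.expectation p f = measure_pmf.expectation p g"
  by (rule integral_cong_AE) (use assms in \<open>auto simp: AE_measure_pmf_iff\<close>)

lemma prob_eq_expectation:
  "measure_pmf.prob p A = measure_pmf.expectation p (\<lambda>x. indicator A x :: real)"
  by simp

lemma prob_le_expectation:
  fixes f :: "'a \<Rightarrow> real"
  assumes "finite (set_pmf p)" "\<And>x. x \<in> set_pmf p \<Longrightarrow> 0 \<le> f x"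
    and "\<And>x. x \<in> set_pmf p \<Longrightarrow> x \<in> A \<Longrightarrow> 1 \<le> f x"
  shows "measure_pmf.prob p A \<le> measure_pmf.expectation p f"
  unfolding prob_eq_expectation
  by (rule expectation_mono_finite) (use assms in \<open>auto simp: indicator_def\<close>)

lemma finite_set_replicate_pmf:
  "finite (set_pmf p) \<Longrightarrow> finite (set_pmf (replicate_pmf m p))"
  using finite_lists_length_eq[of "set_pmf p" m]
  by (simp add: set_replicate_pmf lists_eq_set subset_iff Ball_def)

lemma expectation_replicate_Suc:
  fixes f :: "'a list \<Rightarrow> real"
  assumes "finite (set_pmf p)"
  shows "measure_pmf.expectation (replicate_pmf (Suc m) p) f
    = measure_pmf.expectation p (\<lambda>x. measure_pmf.expectation (replicate_pmf m p) (\<lambda>ws. f (x # ws)))"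
  using assms finite_set_replicate_pmf[OF assms] by (simp add: expectation_bind_finite)

lemma expectation_replicate_sum:
  fixes f :: "'a \<Rightarrow> real"
  assumes "finite (set_pmf p)"
  shows "measure_pmf.expectation (replicate_pmf m p) (\<lambda>ws. \<Sum>w\<leftarrow>ws. f w)
    = real m * measure_pmf.expectation p f"
proof (induction m)
  case (Suc m)
  note fin = finite_set_replicate_pmf[OF assms]
  have int: "integrable (measure_pmf (replicate_pmf m p)) g" for g :: "'a list \<Rightarrow> real"
    by (rule integrable_measure_pmf_finite[OF fin])
  have "measure_pmf.expectation (replicate_pmf (Suc m) p) (\<lambda>ws. \<Sum>w\<leftarrow>ws. f w)
     = measure_pmf.expectation p (\<lambda>x. f x + real m * measure_pmf.expectation p f)"
    unfolding expectation_replicate_Suc[OF assms] by (simp add: Suc.IH int)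
  also have "\<dots> = measure_pmf.expectation p f + real m * measure_pmf.expectation p f"
    using assms by (simp add: integrable_measure_pmf_finite)
  finally show ?case by (simp add: algebra_simps)
qed simp

lemma prob_replicate_not_in:
  assumes "finite (set_pmf p)"
  shows "measure_pmf.prob (replicate_pmf m p) {ws. w \<notin> set ws} = (1 - pmf p w) ^ m"
proof (induction m)
  case (Suc m)
  note fin = finite_set_replicate_pmf[OF assms]
  have *: "(indicator {ws. w \<notin> set ws} (x # ws) :: real)
      = indicator (- {w}) x * indicator {ws. w \<notin> set ws} ws" for x ws
    by (auto simp: indicator_def)
  have "measure_pmf.prob (replicate_pmf (Suc m) p) {ws. w \<notin> set ws}
     = measure_pmf.expectation p (\<lambda>x. measure_pmf.expectation (replicate_pmf m p)
         (\<lambda>ws. indicator {ws. w \<notin> set ws} (x # ws)))"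
    unfolding prob_eq_expectation by (rule expectation_replicate_Suc[OF assms])
  also have "\<dots> = measure_pmf.expectation p (\<lambda>x. indicator (- {w}) x * (1 - pmf p w) ^ m)"
    unfolding * by (simp add: Suc.IH)
  also have "\<dots> = measure_pmf.prob p (- {w}) * (1 - pmf p w) ^ m"
    by simp
  also have "measure_pmf.prob p (- {w}) = 1 - pmf p w"
    using measure_pmf.prob_compl[of "{w}" p] by (simp add: Compl_eq_Diff_UNIV measure_pmf_single)
  finally show ?case by simp
qed simp

section \<open>One step of the attachment process\<close>

text \<open>
  Kept as a multiset because parallel arcs have to be counted with multiplicity: a newly added
  vertex then has exactly the multiset of its choices as out-neighbours.
\<close>

definition out_nbrs :: "multigraph \<Rightarrow> nat \<Rightarrow> nat multiset" where
  "out_nbrs G v = image_mset snd {#a \<in># arcs (DAG G). fst a = v#}"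

lemma set_neighbor_pmf:
  assumes "m \<ge> 1" "n \<ge> 1" "G \<in> set_pmf (pref_attach m n)"
  shows "set_pmf (neighbor_pmf G) \<subseteq> {1..n}"
  using pmf_neighbor_pmf[OF assms] by (auto simp: set_pmf_iff split: if_splits)

lemma finite_neighbor_pmf:
  assumes "m \<ge> 1" "n \<ge> 1" "G \<in> set_pmf (pref_attach m n)"
  shows "finite (set_pmf (neighbor_pmf G))"
  using set_neighbor_pmf[OF assms] finite_subset by blast

lemma pref_attach_Suc:
  assumes "n \<ge> 1"
  shows "pref_attach m (Suc n) = bind_pmf (pref_attach m n)
     (\<lambda>G. map_pmf (attach G (Suc n)) (replicate_pmf m (neighbor_pmf G)))"
  using assms by (cases n) (auto simp: map_pmf_def)

lemma finite_pref_attach: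
  assumes "m \<ge> 1"
  shows "finite (set_pmf (pref_attach m n))"
proof (induction n)
  case (Suc n)
  show ?case
  proof (cases "n = 0")
    case False
    then show ?thesis
      using Suc assms by (auto simp: pref_attach_Suc
          intro!: finite_imageI finite_set_replicate_pmf finite_neighbor_pmf[of m n])
  qed auto
qed auto

lemma expectation_pref_attach_Suc:
  fixes f :: "multigraph \<Rightarrow> real"
  assumes "m \<ge> 1" "n \<ge> 1"
  shows "measure_pmf.expectation (pref_attach m (Suc n)) f = measure_pmf.expectation (pref_attach m n)
     (\<lambda>G. measure_pmf.expectation (replicate_pmf m (neighbor_pmf G)) (\<lambda>ws. f (attach G (Suc n) ws)))"
  using assms finite_pref_attach[OF assms(1)]
  by (simp add: pref_attach_Suc expectation_bind_finite finite_set_replicate_pmf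
      finite_neighbor_pmf[OF assms])

lemma set_choices:
  assumes "m \<ge> 1" "n \<ge> 1" "G \<in> set_pmf (pref_attach m n)"
    and "ws \<in> set_pmf (replicate_pmf m (neighbor_pmf G))"
  shows "set ws \<subseteq> {1..n}" "length ws = m"
  using assms(4) set_neighbor_pmf[OF assms(1-3)] by (auto simp: set_replicate_pmf lists_def)

lemma pref_attach_induct [consumes 3, case_names base step]:
  assumes "m \<ge> 1" "n \<ge> 1" "G \<in> set_pmf (pref_attach m n)"
    and "P 1 (Multigraph {1} (replicate_mset m {1}))"
    and "\<And>n G ws. n \<ge> 1 \<Longrightarrow> G \<in> set_pmf (pref_attach m n) \<Longrightarrow> set ws \<subseteq> {1..n} \<Longrightarrow> length ws = m
      \<Longrightarrow> P n G \<Longrightarrow> P (Suc n) (attach G (Suc n) ws)"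
  shows "P n G"
  using assms(2,3)
proof (induction n arbitrary: G rule: dec_induct)
  case base
  then show ?case using assms(4) by simp
next
  case (step n)
  from step.prems step.hyps obtain H ws where H: "H \<in> set_pmf (pref_attach m n)"
      "ws \<in> set_pmf (replicate_pmf m (neighbor_pmf H))" "G = attach H (Suc n) ws"
    by (auto simp: pref_attach_Suc)
  then show ?case
    using assms(5) step.hyps step.IH set_choices[OF assms(1) _ H(1,2)] by auto
qed

text \<open>
  The normalising constant is the sum of all degrees, \<open>m * (2 * n - 1)\<close>. Degree-weighted sums over the
  vertices therefore have a closed recursion under attachment.
\<close>

lemma expectation_neighbor_pmf:
  fixes f :: "nat \<Rightarrow> real"
  assumes "m \<ge> 1" "n \<ge> 1" "G \<in> set_pmf (pref_attach m n)"
  shows "measure_pmf.expectation (neighbor_pmf G) f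
    = (\<Sum>v=1..n. real (vdeg G v) * f v) / (real m * (2 * real n - 1))"
proof -
  have "measure_pmf.expectation (neighbor_pmf G) f = (\<Sum>v=1..n. pmf (neighbor_pmf G) v * f v)"
    using integral_measure_pmf[of "{1..n}" "neighbor_pmf G" f] set_neighbor_pmf[OF assms]
    by (simp add: subset_iff)
  also have "\<dots> = (\<Sum>v=1..n. real (vdeg G v) * f v / (real m * (2 * real n - 1)))"
    by (intro sum.cong) (auto simp: pmf_neighbor_pmf[OF assms] algebra_simps)
  finally show ?thesis by (simp add: sum_divide_distrib)
qed

lemma vdeg_attach:
  assumes "\<And>e. e \<in># edges G \<Longrightarrow> e \<subseteq> {1..n}" "set ws \<subseteq> {1..n}"
  shows "vdeg (attach G (Suc n) ws) v = (if v = Suc n then length ws else vdeg G v + count (mset ws) v)"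
proof (cases "v = Suc n")
  case True
  have "{#e \<in># edges G. Suc n \<in> e#} = {#}" using assms(1) by fastforce
  then show ?thesis using True by (simp add: vdeg_def attach_def filter_mset_image_mset)
next
  case False
  have "size {#e \<in># image_mset (\<lambda>w. {Suc n, w}) (mset ws). v \<in> e#} = count (mset ws) v"
    using False by (induction ws) auto
  then show ?thesis using False by (simp add: vdeg_def attach_def)
qed

lemma arcs_attach:
  assumes "set ws \<subseteq> {1..n}"
  shows "arcs (DAG (attach G (Suc n) ws)) = arcs (DAG G) + image_mset (\<lambda>w. (Suc n, w)) (mset ws)"
proof -
  have "image_mset (\<lambda>e. (Max e, Min e)) {#e \<in># image_mset (\<lambda>w. {Suc n, w}) (mset ws). card e = 2#}
      = image_mset (\<lambda>w. (Suc n, w)) (mset ws)"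
    using assms by (induction ws) (auto simp: max_def min_def)
  then show ?thesis by (simp add: DAG_def attach_def)
qed

lemma out_nbrs_attach:
  assumes "set ws \<subseteq> {1..n}"
  shows "out_nbrs (attach G (Suc n) ws) v = out_nbrs G v + (if v = Suc n then mset ws else {#})"
proof -
  have "image_mset snd (filter_mset (\<lambda>a. fst a = v) (image_mset (\<lambda>w. (Suc n, w)) (mset ws)))
      = (if v = Suc n then mset ws else {#})"
    by (induction ws) auto
  then show ?thesis by (simp add: out_nbrs_def arcs_attach[OF assms])
qed

lemma arcs_bounds:
  assumes "m \<ge> 1" "n \<ge> 1" "G \<in> set_pmf (pref_attach m n)" "(u, v) \<in># arcs (DAG G)"
  shows "1 \<le> v" "v < u" "u \<le> n"
proof -
  have "\<forall>u v. (u, v) \<in># arcs (DAG G) \<longrightarrow> 1 \<le> v \<and> v < u \<and> u \<le> n"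
    using assms(1-3)
  proof (induction rule: pref_attach_induct)
    case base
    then show ?case by (auto simp: DAG_def split: if_splits)
  next
    case (step n G ws)
    then have "(u, v) \<in># arcs (DAG G) \<or> u = Suc n \<and> v \<in> set ws"
      if "(u, v) \<in># arcs (DAG (attach G (Suc n) ws))" for u v
      using that by (auto simp: arcs_attach)
    then show ?case using step by fastforce
  qed
  then show "1 \<le> v" "v < u" "u \<le> n" using assms(4) by auto
qed

lemma size_out_nbrs:
  assumes "m \<ge> 1" "n \<ge> 1" "G \<in> set_pmf (pref_attach m n)"
  shows "size (out_nbrs G v) \<le> m" "v > n \<Longrightarrow> out_nbrs G v = {#}"
proof -
  have "(v > n \<longrightarrow> out_nbrs G v = {#}) \<and> size (out_nbrs G v) \<le> m"
    using assms(1-3)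
  proof (induction rule: pref_attach_induct)
    case base
    have "{#e \<in># replicate_mset m {Suc 0}. card e = 2#} = {#}"
      by (auto simp: filter_mset_eq_conv split: if_splits)
    then have "arcs (DAG (Multigraph {Suc 0} (replicate_mset m {Suc 0}))) = {#}"
      by (simp add: DAG_def)
    then show ?case by (simp add: out_nbrs_def)
  qed (auto simp: out_nbrs_attach)
  then show "size (out_nbrs G v) \<le> m" "v > n \<Longrightarrow> out_nbrs G v = {#}" by auto
qed

lemma vdeg_ge:
  assumes "m \<ge> 1" "n \<ge> 1" "G \<in> set_pmf (pref_attach m n)"
  shows "v \<in> {1..n} \<Longrightarrow> vdeg G v \<ge> m" "vdeg G n = m"
proof -
  have "(v \<in> {1..n} \<longrightarrow> vdeg G v \<ge> m) \<and> vdeg G n = m"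
    using assms(1-3)
  proof (induction rule: pref_attach_induct)
    case base
    have "{#e \<in># replicate_mset m {Suc 0}. Suc 0 \<in> e#} = replicate_mset m {Suc 0}"
      by (auto simp: filter_mset_eq_conv split: if_splits)
    then show ?case by (auto simp: vdeg_def)
  next
    case (step n G ws)
    then show ?case
      using pref_attach_invariant(2)[OF assms(1) step(1,2)] by (auto simp: vdeg_attach)
  qed
  then show "v \<in> {1..n} \<Longrightarrow> vdeg G v \<ge> m" "vdeg G n = m" by auto
qed

text \<open>
  All moment estimates below are instances: \<open>f t\<close> is a time-dependent functional of the graph whose
  conditional expectation grows by at most \<open>c\<close> per added vertex, so \<open>c = 0\<close> is the supermartingale
  case.
\<close>

lemma expectation_drift:
  fixes f :: "nat \<Rightarrow> multigraph \<Rightarrow> real"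
  assumes "m \<ge> 1" "k \<ge> 1" "k \<le> n"
    and "\<And>G. G \<in> set_pmf (pref_attach m k) \<Longrightarrow> f k G \<le> a"
    and "\<And>t G. k \<le> t \<Longrightarrow> t < n \<Longrightarrow> G \<in> set_pmf (pref_attach m t) \<Longrightarrow>
      measure_pmf.expectation (replicate_pmf m (neighbor_pmf G)) (\<lambda>ws. f (Suc t) (attach G (Suc t) ws))
        \<le> f t G + c"
  shows "measure_pmf.expectation (pref_attach m n) (f n) \<le> a + c * real (n - k)"
  using assms(3,5)
proof (induction n rule: dec_induct)
  case base
  have "measure_pmf.expectation (pref_attach m k) (f k) \<le> measure_pmf.expectation (pref_attach m k) (\<lambda>_. a)"
    by (rule expectation_mono_finite) (use assms finite_pref_attach in auto)
  then show ?case by simp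
next
  case (step n)
  have fin: "finite (set_pmf (pref_attach m n))" using finite_pref_attach assms(1) .
  have "measure_pmf.expectation (pref_attach m (Suc n)) (f (Suc n))
     \<le> measure_pmf.expectation (pref_attach m n) (\<lambda>G. f n G + c)"
    using step.hyps assms(1,2) step.prems
    by (subst expectation_pref_attach_Suc) (auto intro!: expectation_mono_finite fin)
  also have "\<dots> = measure_pmf.expectation (pref_attach m n) (f n) + c"
    by (simp add: integrable_measure_pmf_finite[OF fin])
  also have "\<dots> \<le> a + c * real (Suc n - k)"
    using step.IH step.prems step.hyps by (simp add: Suc_diff_le algebra_simps)
  finally show ?case .
qed

section \<open>Layers and directed paths\<close>

lemma outside_first_layers_antimono:
  "l \<le> l' \<Longrightarrow> outside_first_layers G l' \<subseteq> outside_first_layers G l"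
  by (auto simp: outside_first_layers_def)

text \<open>
  Suppose that all in-neighbours of \<open>v\<close> lie in the first \<open>l\<close> layers. If there are none, \<open>v\<close> belongs to
  layer 1. Otherwise let the first \<open>i\<close> layers contain all of them with \<open>i\<close> least possible; then some
  in-neighbour lies in layer \<open>i\<close> itself, and \<open>v\<close> belongs to layer \<open>i + 1\<close>.
\<close>

lemma outside_first_layers_Suc:
  assumes "m \<ge> 1" "n \<ge> 1" "G \<in> set_pmf (pref_attach m n)"
    and v: "v \<in> outside_first_layers G (Suc l)"
  shows "\<exists>u. (u, v) \<in># arcs (DAG G) \<and> u \<in> outside_first_layers G l"
proof (rule ccontr)
  let ?D = "DAG G"
  have V: "dverts ?D = verts G" "verts G = {1..n}"
    using pref_attach_invariant(1)[OF assms(1-3)] by (auto simp: DAG_def)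
  have vV: "v \<in> dverts ?D" and out: "\<And>j. 1 \<le> j \<Longrightarrow> j \<le> Suc l \<Longrightarrow> v \<notin> layer ?D j"
    using v V by (auto simp: outside_first_layers_def)
  define P where "P i \<longleftrightarrow> (\<forall>u. (u, v) \<in># arcs ?D \<longrightarrow> u \<in> (\<Union>j\<in>{1..i}. layer ?D j))" for i
  assume "\<not> ?thesis"
  then have "P l"
    using arcs_bounds[OF assms(1-3)] V by (force simp: P_def outside_first_layers_def)
  show False
  proof (cases "P 0")
    case True
    then have "{#a \<in># arcs ?D. snd a = v#} = {#}" by (auto simp: P_def filter_mset_eq_mempty_iff)
    then have "v \<in> layer ?D 1" using vV by (simp add: in_deg_def)
    then show False using out[of 1] by simp
  next
    case False
    then obtain i where i: "i < l" "\<not> P i" "P (Suc i)"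
      using \<open>P l\<close> ex_least_nat_less[of P l] by auto
    from i(2) obtain u where u: "(u, v) \<in># arcs ?D" "u \<notin> (\<Union>j\<in>{1..i}. layer ?D j)"
      by (auto simp: P_def)
    moreover have "u \<in> (\<Union>j\<in>{1..Suc i}. layer ?D j)" using i(3) u(1) by (auto simp: P_def)
    ultimately have "u \<in> layer ?D (Suc i)" by (auto simp: le_Suc_eq)
    then have "v \<in> layer ?D (Suc (Suc i))"
      using i(3) u(1) vV unfolding P_def layer.simps by blast
    then show False using out[of "Suc (Suc i)"] i(1) by simp
  qed
qed

text \<open>
  Arcs point from larger to smaller vertices, so a path whose last vertex exceeds \<open>k\<close> has only such
  arcs.
\<close>

definition late_arcs :: "multigraph \<Rightarrow> nat \<Rightarrow> (nat \<times> nat) set" where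
  "late_arcs G k = {(u, v). (u, v) \<in># arcs (DAG G) \<and> k < v}"

lemma outside_first_layers_path:
  assumes "m \<ge> 1" "n \<ge> 1" "G \<in> set_pmf (pref_attach m n)"
    and "v \<in> outside_first_layers G l" "k < v"
  shows "\<exists>u\<in>{k<..n}. (u, v) \<in> late_arcs G k ^^ l"
  using assms(4,5)
proof (induction l arbitrary: v)
  case 0
  then show ?case
    using pref_attach_invariant(1)[OF assms(1-3)] by (auto simp: outside_first_layers_def)
next
  case (Suc l)
  obtain w where w: "(w, v) \<in># arcs (DAG G)" "w \<in> outside_first_layers G l"
    using outside_first_layers_Suc[OF assms(1-3) Suc.prems(1)] by blast
  then have "k < w" "(w, v) \<in> late_arcs G k"
    using arcs_bounds(2)[OF assms(1-3) w(1)] Suc.prems(2) by (auto simp: late_arcs_def)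
  then show ?case using Suc.IH[OF w(2)] by (auto intro: relcompI)
qed

text \<open>
  This is \<open>\<Sum>j\<le>l. 2 ^ j * p j\<close>, where \<open>p j\<close> counts the paths with \<open>j\<close> arcs that start at \<open>v\<close> and
  stay above \<open>k\<close>. Summing over all lengths up to \<open>l\<close> instead of counting only paths with exactly
  \<open>l\<close> arcs makes the recursion close up in a single quantity, and the factor 2 per arc turns a
  bound on this quantity into one on the number of long paths that decays like \<open>2 ^ (- l)\<close>.
\<close>

fun path_weight :: "multigraph \<Rightarrow> nat \<Rightarrow> nat \<Rightarrow> nat \<Rightarrow> nat" where
  "path_weight G k 0 v = (if k < v then 1 else 0)"
| "path_weight G k (Suc l) v =
     (if k < v then 1 + 2 * (\<Sum>w\<in>#out_nbrs G v. path_weight G k l w) else 0)"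

lemma path_weight_mono: "path_weight G k l v \<le> path_weight G k (Suc l) v"
proof (induction l arbitrary: v)
  case (Suc l)
  have "(\<Sum>w\<in>#out_nbrs G v. path_weight G k l w) \<le> (\<Sum>w\<in>#out_nbrs G v. path_weight G k (Suc l) w)"
    by (intro sum_mset_mono Suc.IH)
  then show ?case
    unfolding path_weight.simps(2)[of G k "Suc l" v] path_weight.simps(2)[of G k l v]
    by (cases "k < v") (simp_all only: if_True if_False add_left_mono mult_le_mono2 order_refl)
qed auto

lemma path_weight_le:
  assumes "m \<ge> 1" "n \<ge> 1" "G \<in> set_pmf (pref_attach m n)"
  shows "path_weight G k l v \<le> (2 * m + 1) ^ l"
proof (induction l arbitrary: v)
  case (Suc l)
  have "(\<Sum>w\<in>#out_nbrs G v. path_weight G k l w) \<le> (\<Sum>w\<in>#out_nbrs G v. (2 * m + 1) ^ l)"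
    by (intro sum_mset_mono Suc)
  also have "\<dots> = size (out_nbrs G v) * (2 * m + 1) ^ l" by simp
  also have "\<dots> \<le> m * (2 * m + 1) ^ l" using size_out_nbrs(1)[OF assms] by (rule mult_right_mono) simp
  finally have "path_weight G k (Suc l) v \<le> 1 + 2 * (m * (2 * m + 1) ^ l)" by simp
  also have "\<dots> \<le> (2 * m + 1) ^ Suc l" by (simp add: algebra_simps)
  finally show ?case .
qed simp

lemma in_out_nbrs: "w \<in># out_nbrs G v \<longleftrightarrow> (v, w) \<in># arcs (DAG G)"
  by (force simp: out_nbrs_def)

text \<open>
  A vertex acquires no outgoing arcs after its creation, so its weight is final.
\<close>

lemma path_weight_attach:
  assumes "m \<ge> 1" "n \<ge> 1" "G \<in> set_pmf (pref_attach m n)" "set ws \<subseteq> {1..n}" "v \<le> n"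
  shows "path_weight (attach G (Suc n) ws) k l v = path_weight G k l v"
  using assms(5)
proof (induction l arbitrary: v)
  case (Suc l)
  have "(\<Sum>w\<in>#out_nbrs G v. path_weight (attach G (Suc n) ws) k l w) = (\<Sum>w\<in>#out_nbrs G v. path_weight G k l w)"
  proof (intro arg_cong[of _ _ sum_mset] image_mset_cong Suc.IH)
    fix w assume "w \<in># out_nbrs G v"
    then show "w \<le> n" using arcs_bounds[OF assms(1-3)] Suc.prems by (fastforce simp: in_out_nbrs)
  qed
  then show ?case using Suc.prems by (simp add: out_nbrs_attach[OF assms(4)])
qed simp

lemma sum_set_mset_le:
  fixes f :: "'a \<Rightarrow> nat"
  shows "sum f (set_mset M) \<le> (\<Sum>x\<in>#M. f x)"
proof (induction M)
  case (add x M)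
  have "sum f (set_mset (add_mset x M)) \<le> f x + sum f (set_mset M)"
    by (simp add: sum.insert_if)
  then show ?case using add by simp
qed simp

lemma sum_count_mset_list:
  fixes f :: "'a \<Rightarrow> nat"
  assumes "finite A" "set ws \<subseteq> A"
  shows "(\<Sum>x\<in>A. count (mset ws) x * f x) = (\<Sum>w\<leftarrow>ws. f w)"
  using assms(2)
proof (induction ws)
  case (Cons w ws)
  have "(\<Sum>x\<in>A. count (mset (w # ws)) x * f x)
      = (\<Sum>x\<in>A. (if w = x then f x else 0) + count (mset ws) x * f x)"
    by (intro sum.cong) auto
  also have "\<dots> = f w + (\<Sum>x\<in>A. count (mset ws) x * f x)"
    using Cons.prems assms(1) by (simp add: sum.distrib)
  finally show ?case using Cons by simp
qed simp

text \<open>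
  The ends of paths with \<open>l + 1\<close> arcs from \<open>u\<close> are the ends of paths with \<open>l\<close> arcs from the
  out-neighbours of \<open>u\<close>, and one more arc doubles the weight.
\<close>

lemma card_path_ends_le:
  assumes "k < u"
  shows "finite {v. (u, v) \<in> late_arcs G k ^^ l}"
    "2 ^ l * card {v. (u, v) \<in> late_arcs G k ^^ l} \<le> path_weight G k l u"
proof -
  have "finite {v. (u, v) \<in> late_arcs G k ^^ l} \<and>
    2 ^ l * card {v. (u, v) \<in> late_arcs G k ^^ l} \<le> path_weight G k l u"
    using assms
  proof (induction l arbitrary: u)
    case (Suc l)
    define N where "N = {w \<in> set_mset (out_nbrs G u). k < w}"
    let ?E = "\<lambda>w. {v. (w, v) \<in> late_arcs G k ^^ l}"
    have fin: "finite N" by (simp add: N_def)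
    have eq: "{v. (u, v) \<in> late_arcs G k ^^ Suc l} = (\<Union>w\<in>N. ?E w)"
      unfolding relpow_Suc_D2 relpow_commute[symmetric] relpow.simps
      by (auto simp: N_def in_out_nbrs late_arcs_def)
    have IH: "finite (?E w)" "2 ^ l * card (?E w) \<le> path_weight G k l w" if "w \<in> N" for w
      using Suc.IH[of w] that by (auto simp: N_def)
    have "2 ^ l * card (\<Union>w\<in>N. ?E w) \<le> 2 ^ l * (\<Sum>w\<in>N. card (?E w))"
      by (intro mult_left_mono card_UN_le fin) simp
    also have "\<dots> \<le> (\<Sum>w\<in>N. path_weight G k l w)"
      unfolding sum_distrib_left by (intro sum_mono IH)
    also have "\<dots> \<le> (\<Sum>w\<in>set_mset (out_nbrs G u). path_weight G k l w)"
      by (rule sum_mono2) (auto simp: N_def)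
    also have "\<dots> \<le> (\<Sum>w\<in>#out_nbrs G u. path_weight G k l w)"
      by (rule sum_set_mset_le)
    finally have "2 ^ Suc l * card {v. (u, v) \<in> late_arcs G k ^^ Suc l} \<le> path_weight G k (Suc l) u"
      using Suc.prems unfolding eq by simp
    then show ?case unfolding eq using fin IH by auto
  qed auto
  then show "finite {v. (u, v) \<in> late_arcs G k ^^ l}"
    "2 ^ l * card {v. (u, v) \<in> late_arcs G k ^^ l} \<le> path_weight G k l u" by auto
qed

text \<open>
  The degree factors are the attachment probabilities up to normalisation, so the expected weight of
  a random neighbour is proportional to this sum.
\<close>

definition total_weight :: "multigraph \<Rightarrow> nat \<Rightarrow> nat \<Rightarrow> nat" where
  "total_weight G k l = (\<Sum>v\<in>verts G. vdeg G v * path_weight G k l v)"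

text \<open>
  Every vertex outside the first \<open>l\<close> layers ends some path with \<open>l\<close> arcs, and the degree of the
  start of the path is at least \<open>m\<close>.
\<close>

lemma card_outside_le_total_weight:
  assumes "m \<ge> 1" "n \<ge> 1" "G \<in> set_pmf (pref_attach m n)"
  shows "m * 2 ^ l * card (outside_first_layers G l \<inter> {k<..}) \<le> total_weight G k l"
proof -
  have V: "verts G = {1..n}" using pref_attach_invariant(1)[OF assms] .
  let ?E = "\<lambda>u. {v. (u, v) \<in> late_arcs G k ^^ l}"
  have "outside_first_layers G l \<inter> {k<..} \<subseteq> (\<Union>u\<in>{k<..n}. ?E u)"
    using outside_first_layers_path[OF assms] by fastforce
  then have "card (outside_first_layers G l \<inter> {k<..}) \<le> card (\<Union>u\<in>{k<..n}. ?E u)"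
    by (rule card_mono[rotated]) (auto simp: card_path_ends_le)
  also have "\<dots> \<le> (\<Sum>u\<in>{k<..n}. card (?E u))" by (rule card_UN_le) simp
  finally have "m * 2 ^ l * card (outside_first_layers G l \<inter> {k<..})
      \<le> (\<Sum>u\<in>{k<..n}. m * (2 ^ l * card (?E u)))"
    by (simp flip: sum_distrib_left add: mult.assoc)
  also have "\<dots> \<le> (\<Sum>u\<in>{k<..n}. vdeg G u * path_weight G k l u)"
    by (intro sum_mono mult_mono card_path_ends_le vdeg_ge[OF assms]) auto
  also have "\<dots> \<le> total_weight G k l"
    unfolding total_weight_def V by (rule sum_mono2) auto
  finally show ?thesis .
qed

text \<open>
  Each choice \<open>w\<close> raises the degree of \<open>w\<close> by one and adds at most twice the weight of \<open>w\<close> to the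
  weight of the new vertex, whose degree is \<open>m\<close>.
\<close>

lemma total_weight_attach_le:
  assumes "m \<ge> 1" "n \<ge> 1" "G \<in> set_pmf (pref_attach m n)" "set ws \<subseteq> {1..n}" "length ws = m"
  shows "total_weight (attach G (Suc n) ws) k l
    \<le> total_weight G k l + m + (2 * m + 1) * (\<Sum>w\<leftarrow>ws. path_weight G k l w)"
proof -
  let ?G = "attach G (Suc n) ws" and ?W = "\<Sum>w\<leftarrow>ws. path_weight G k l w"
  have V: "verts G = {1..n}" "verts ?G = {1..Suc n}"
    using pref_attach_invariant(1)[OF assms(1-3)] by (auto simp: attach_def)
  note deg = vdeg_attach[OF pref_attach_invariant(2)[OF assms(1-3)] assms(4)]
  have out: "out_nbrs ?G (Suc n) = mset ws"
    using size_out_nbrs(2)[OF assms(1-3)] by (simp add: out_nbrs_attach[OF assms(4)])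
  have new: "path_weight ?G k l (Suc n) \<le> 1 + 2 * ?W"
  proof (cases l)
    case (Suc l')
    have "(\<Sum>w\<in>#mset ws. path_weight ?G k l' w) \<le> (\<Sum>w\<in>#mset ws. path_weight G k l w)"
      using path_weight_mono[of G k l'] assms(4) unfolding Suc
      by (intro sum_mset_mono) (auto simp: path_weight_attach[OF assms(1-4)] subset_iff simp del: path_weight.simps)
    also have "\<dots> = ?W" by (simp flip: sum_mset_sum_list)
    finally show ?thesis by (simp add: Suc out)
  qed auto
  have "total_weight ?G k l = (\<Sum>v=1..n. vdeg ?G v * path_weight ?G k l v) + m * path_weight ?G k l (Suc n)"
    using assms(5) by (simp add: total_weight_def V deg)
  also have "(\<Sum>v=1..n. vdeg ?G v * path_weight ?G k l v)
      = (\<Sum>v=1..n. (vdeg G v + count (mset ws) v) * path_weight G k l v)"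
    by (intro sum.cong) (auto simp: deg path_weight_attach[OF assms(1-4)])
  also have "\<dots> = total_weight G k l + (\<Sum>v=1..n. count (mset ws) v * path_weight G k l v)"
    by (simp add: total_weight_def V sum.distrib algebra_simps)
  also have "(\<Sum>v=1..n. count (mset ws) v * path_weight G k l v) = ?W"
    using assms(4) by (intro sum_count_mset_list) auto
  finally have "total_weight ?G k l = total_weight G k l + ?W + m * path_weight ?G k l (Suc n)" .
  also have "\<dots> \<le> total_weight G k l + ?W + m * (1 + 2 * ?W)"
    by (intro add_left_mono mult_left_mono new) simp
  finally show ?thesis by (simp add: algebra_simps)
qed

lemma expectation_choices_path_weight:
  assumes "m \<ge> 1" "n \<ge> 1" "G \<in> set_pmf (pref_attach m n)"
  shows "measure_pmf.expectation (replicate_pmf m (neighbor_pmf G)) (\<lambda>ws. \<Sum>w\<leftarrow>ws. real (path_weight G k l w))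
    = real (total_weight G k l) / (2 * real n - 1)"
  using assms(1) pref_attach_invariant(1)[OF assms]
  by (simp add: expectation_replicate_sum finite_neighbor_pmf[OF assms] expectation_neighbor_pmf[OF assms] total_weight_def)

section \<open>Drift of the total weight\<close>

lemma path_weight_early: "v \<le> k \<Longrightarrow> path_weight G k l v = 0"
  by (cases l) auto

text \<open>
  Bernoulli's inequality. The right-hand side is chosen because its product over consecutive \<open>t\<close>
  telescopes.
\<close>

lemma growth_factor_le:
  fixes t :: real
  assumes "t > 1"
  shows "1 + (2 * real m + 1) / (2 * t - 1) \<le> (t / (t - 1)) ^ (m + 1)"
proof -
  have "(2 * real m + 1) / (2 * t - 1) \<le> (real m + 1) / (t - 1)"
    using assms by (simp add: divide_simps) (simp add: algebra_simps)
  moreover have "1 + real (m + 1) * (1 / (t - 1)) \<le> (1 + 1 / (t - 1)) ^ (m + 1)"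
    using assms by (intro Bernoulli_inequality) (simp add: order_trans[of "-1" 0])
  moreover have "1 + 1 / (t - 1) = t / (t - 1)" using assms by (simp add: field_simps)
  ultimately show ?thesis by (simp add: field_simps)
qed

text \<open>
  The factor in front of the total weight compensates its expected growth since time \<open>k\<close>, and the
  term subtracted accounts for the new vertices, which add at most \<open>m\<close> each. What remains has
  nonpositive drift.
\<close>

definition excess :: "nat \<Rightarrow> nat \<Rightarrow> nat \<Rightarrow> nat \<Rightarrow> multigraph \<Rightarrow> real" where
  "excess m k l t G = (real k / (real t - 1)) ^ (m + 1) * real (total_weight G k l)
     - real m * (real t - real k)"

lemma excess_start:
  fixes l :: nat
  assumes "m \<ge> 1" "k \<ge> 1" "G \<in> set_pmf (pref_attach m k)"
  shows "excess m k l k G = 0"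
  using pref_attach_invariant(1)[OF assms] by (simp add: excess_def total_weight_def path_weight_early)

text \<open>
  When the vertex \<open>t + 1\<close> makes the choices \<open>ws\<close>, the increment of \<open>excess\<close> is at most this amount,
  whose expectation is 0.
\<close>

definition noise :: "nat \<Rightarrow> nat \<Rightarrow> nat \<Rightarrow> nat \<Rightarrow> multigraph \<Rightarrow> nat list \<Rightarrow> real" where
  "noise m k l t G ws = (real k / real t) ^ (m + 1) * (2 * real m + 1) *
     ((\<Sum>w\<leftarrow>ws. real (path_weight G k l w)) - real (total_weight G k l) / (2 * real t - 1))"

context
  fixes m k l t :: nat and G :: multigraph
  assumes m: "m \<ge> 1" and k: "2 \<le> k" "k \<le> t" and G: "G \<in> set_pmf (pref_attach m t)"
begin

lemma t_ge_1: "t \<ge> 1"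
  using k by simp

lemma decay_le_1: "0 \<le> (real k / real t) ^ (m + 1)" "(real k / real t) ^ (m + 1) \<le> 1"
  using k by (auto intro!: power_le_one simp del: power_Suc)

lemma excess_step:
  assumes "ws \<in> set_pmf (replicate_pmf m (neighbor_pmf G))"
  shows "excess m k l (Suc t) (attach G (Suc t) ws) \<le> excess m k l t G + noise m k l t G ws"
proof -
  define c where "c = (real k / real t) ^ (m + 1)"
  define S where "S = real (total_weight G k l)"
  define Y where "Y = (\<Sum>w\<leftarrow>ws. real (path_weight G k l w))"
  have c: "0 \<le> c" "c \<le> 1" unfolding c_def by (rule decay_le_1)+
  have "real (total_weight (attach G (Suc t) ws) k l) \<le> real (total_weight G k l + m + (2 * m + 1) * (\<Sum>w\<leftarrow>ws. path_weight G k l w))"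
    using total_weight_attach_le[OF m t_ge_1 G set_choices[OF m t_ge_1 G assms]] by (simp only: of_nat_le_iff)
  also have "\<dots> = S + m + (2 * real m + 1) * Y"
  proof -
    have "real (\<Sum>w\<leftarrow>ws. path_weight G k l w) = Y" unfolding Y_def by (induction ws) auto
    then show ?thesis by (simp add: S_def algebra_simps)
  qed
  finally have "c * real (total_weight (attach G (Suc t) ws) k l) \<le> c * (S + m + (2 * real m + 1) * Y)"
    using c(1) by (rule mult_left_mono)
  also have "\<dots> = c * (1 + (2 * real m + 1) / (2 * real t - 1)) * S + c * m + noise m k l t G ws"
  proof -
    have "noise m k l t G ws = c * (2 * real m + 1) * (Y - S / (2 * real t - 1))"
      by (simp only: noise_def c_def S_def Y_def)
    then show ?thesis by (simp add: algebra_simps)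
  qed
  also have "c * (1 + (2 * real m + 1) / (2 * real t - 1)) \<le> c * (real t / (real t - 1)) ^ (m + 1)"
    using k c(1) by (intro mult_left_mono growth_factor_le) auto
  also have "\<dots> = (real k / (real t - 1)) ^ (m + 1)"
    using k unfolding c_def by (subst power_mult_distrib[symmetric]) simp
  also have "c * real m \<le> 1 * real m" using c(2) by (intro mult_right_mono) auto
  finally show ?thesis
    by (simp add: excess_def c_def S_def mult_right_mono algebra_simps)
qed

lemma expectation_noise:
  "measure_pmf.expectation (replicate_pmf m (neighbor_pmf G)) (noise m k l t G) = 0"
proof -
  have "integrable (measure_pmf (replicate_pmf m (neighbor_pmf G))) g" for g :: "nat list \<Rightarrow> real"
    using m t_ge_1 G by (intro integrable_measure_pmf_finite finite_set_replicate_pmf finite_neighbor_pmf)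
  then show ?thesis
    unfolding noise_def by (simp add: expectation_choices_path_weight[OF m t_ge_1 G])
qed

text \<open>
  Weights are at most \<open>(2 * m + 1) ^ l\<close>, so both the sum of the \<open>m\<close> chosen weights and its
  expectation lie between 0 and \<open>m * (2 * m + 1) ^ l\<close>.
\<close>

lemma abs_noise_le:
  assumes "ws \<in> set_pmf (replicate_pmf m (neighbor_pmf G))"
  shows "\<bar>noise m k l t G ws\<bar> \<le> real m * (2 * real m + 1) ^ (l + 1)"
proof -
  define B where "B = real m * (2 * real m + 1) ^ l"
  let ?Y = "\<lambda>ws. \<Sum>w\<leftarrow>ws. real (path_weight G k l w)"
  have Y: "0 \<le> ?Y ws" "?Y ws \<le> B" if "ws \<in> set_pmf (replicate_pmf m (neighbor_pmf G))" for ws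
  proof -
    have "real (path_weight G k l w) \<le> (2 * real m + 1) ^ l" for w
      using of_nat_mono[OF path_weight_le[OF m t_ge_1 G, of k l w], where 'a = real]
      by (simp add: add.commute)
    then have "?Y ws \<le> (\<Sum>w\<leftarrow>ws. (2 * real m + 1) ^ l)" by (intro sum_list_mono)
    then show "?Y ws \<le> B" "0 \<le> ?Y ws"
      using set_choices[OF m t_ge_1 G that] by (auto simp: B_def sum_list_triv intro!: sum_list_nonneg)
  qed
  have "measure_pmf.expectation (replicate_pmf m (neighbor_pmf G)) ?Y \<le>
      measure_pmf.expectation (replicate_pmf m (neighbor_pmf G)) (\<lambda>_. B)"
    using m t_ge_1 G Y by (intro expectation_mono_finite finite_set_replicate_pmf finite_neighbor_pmf) auto
  then have "real (total_weight G k l) / (2 * real t - 1) \<le> B"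
    by (simp add: expectation_choices_path_weight[OF m t_ge_1 G])
  moreover have "0 \<le> real (total_weight G k l) / (2 * real t - 1)" using k by simp
  ultimately have "\<bar>?Y ws - real (total_weight G k l) / (2 * real t - 1)\<bar> \<le> B"
    using Y[OF assms] by simp
  moreover have "\<bar>(real k / real t) ^ (m + 1) * (2 * real m + 1)\<bar> \<le> 1 * (2 * real m + 1)"
    unfolding abs_mult using decay_le_1 by (intro mult_mono) auto
  ultimately have "\<bar>noise m k l t G ws\<bar> \<le> 1 * (2 * real m + 1) * B"
    unfolding noise_def abs_mult[of "_ * _"] by (intro mult_mono) (auto simp: B_def)
  then show ?thesis by (simp add: B_def algebra_simps)
qed

end

text \<open>
  When \<open>z\<close> has mean 0, the cross term on the right vanishes in expectation. The positive part is
  essential: the increments of \<open>excess\<close> are only bounded from above, so \<open>excess\<close> may be very negative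
  and its square large.
\<close>

lemma square_pos_part_le:
  fixes x y z :: real
  assumes "x \<le> y + z"
  shows "(max 0 x)\<^sup>2 \<le> (max 0 y)\<^sup>2 + 2 * max 0 y * z + z\<^sup>2"
proof (cases "x \<le> 0")
  case False
  show ?thesis
  proof (cases "y \<ge> 0")
    case True
    then have "x\<^sup>2 \<le> (y + z)\<^sup>2" using assms False by (intro power_mono) auto
    then show ?thesis using True False by (simp add: max_def power2_sum algebra_simps)
  next
    case y: False
    then have "x\<^sup>2 \<le> z\<^sup>2" using assms False by (intro power_mono) auto
    then show ?thesis using y False by (simp add: max_def)
  qed
next
  case True
  have "0 \<le> (max 0 y + z)\<^sup>2" by simp
  then show ?thesis using True by (simp add: max_def power2_sum algebra_simps)
qed

lemma expectation_excess_le: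
  assumes "m \<ge> 1" "2 \<le> k" "k \<le> n"
  shows "measure_pmf.expectation (pref_attach m n) (excess m k l n) \<le> 0"
proof -
  have "measure_pmf.expectation (pref_attach m n) (excess m k l n) \<le> 0 + 0 * real (n - k)"
  proof (rule expectation_drift[OF assms(1) _ assms(3)])
    fix t G assume t: "k \<le> t" and G: "G \<in> set_pmf (pref_attach m t)"
    note A = assms(1,2) t G
    let ?p = "replicate_pmf m (neighbor_pmf G)"
    have fin: "finite (set_pmf ?p)"
      using A by (intro finite_set_replicate_pmf finite_neighbor_pmf[of m t]) auto
    have "measure_pmf.expectation ?p (\<lambda>ws. excess m k l (Suc t) (attach G (Suc t) ws))
        \<le> measure_pmf.expectation ?p (\<lambda>ws. excess m k l t G + noise m k l t G ws)"
      by (intro expectation_mono_finite fin excess_step[OF A])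
    also have "\<dots> = excess m k l t G"
      by (simp add: expectation_noise[OF A] integrable_measure_pmf_finite[OF fin])
    finally show "measure_pmf.expectation ?p (\<lambda>ws. excess m k l (Suc t) (attach G (Suc t) ws))
        \<le> excess m k l t G + 0" by simp
  qed (use assms in \<open>auto simp: excess_start\<close>)
  then show ?thesis by simp
qed

lemma expectation_excess_square_le:
  assumes "m \<ge> 1" "2 \<le> k" "k \<le> n"
  shows "measure_pmf.expectation (pref_attach m n) (\<lambda>G. (max 0 (excess m k l n G))\<^sup>2)
    \<le> (real m * (2 * real m + 1) ^ (l + 1))\<^sup>2 * real n"
proof -
  define V where "V = (real m * (2 * real m + 1) ^ (l + 1))\<^sup>2"
  have "measure_pmf.expectation (pref_attach m n) (\<lambda>G. (max 0 (excess m k l n G))\<^sup>2)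
      \<le> 0 + V * real (n - k)"
  proof (rule expectation_drift[OF assms(1) _ assms(3)])
    fix t G assume t: "k \<le> t" and G: "G \<in> set_pmf (pref_attach m t)"
    note A = assms(1,2) t G
    let ?p = "replicate_pmf m (neighbor_pmf G)" and ?x = "max 0 (excess m k l t G)"
    have fin: "finite (set_pmf ?p)"
      using A by (intro finite_set_replicate_pmf finite_neighbor_pmf[of m t]) auto
    have "measure_pmf.expectation ?p (\<lambda>ws. (max 0 (excess m k l (Suc t) (attach G (Suc t) ws)))\<^sup>2)
        \<le> measure_pmf.expectation ?p (\<lambda>ws. ?x\<^sup>2 + 2 * ?x * noise m k l t G ws + V)"
    proof (intro expectation_mono_finite fin)
      fix ws assume ws: "ws \<in> set_pmf ?p"
      have "(noise m k l t G ws)\<^sup>2 \<le> V"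
        unfolding V_def using abs_noise_le[OF A ws]
        by (metis abs_ge_zero power2_abs power_mono)
      then show "(max 0 (excess m k l (Suc t) (attach G (Suc t) ws)))\<^sup>2
          \<le> ?x\<^sup>2 + 2 * ?x * noise m k l t G ws + V"
        using square_pos_part_le[OF excess_step[OF A ws, of l]] by linarith
    qed
    also have "\<dots> = ?x\<^sup>2 + V"
      by (simp add: expectation_noise[OF A] integrable_measure_pmf_finite[OF fin])
    finally show "measure_pmf.expectation ?p (\<lambda>ws. (max 0 (excess m k l (Suc t) (attach G (Suc t) ws)))\<^sup>2)
        \<le> ?x\<^sup>2 + V" .
  qed (use assms in \<open>auto simp: excess_start\<close>)
  also have "\<dots> \<le> V * real n" by (auto simp: V_def intro!: mult_left_mono)
  finally show ?thesis by (simp add: V_def)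
qed

section \<open>Tail bounds for the number of vertices in deep layers\<close>

text \<open>
  Markov's inequality with \<open>k = 2\<close>. The two arcs that end a path may involve the vertices 1 and 2,
  which carry no weight, so the path is shortened by two arcs.
\<close>

lemma prob_deep_vertex_le:
  assumes "m \<ge> 1" "n \<ge> 2"
  shows "measure_pmf.prob (pref_attach m n) {G. outside_first_layers G l \<noteq> {}} \<le> real n ^ (m + 2) / 2 ^ l"
proof (cases "l < 2")
  case True
  have "(2::real) ^ l \<le> 2 ^ (m + 2)" using True by (intro power_increasing) auto
  also have "\<dots> \<le> real n ^ (m + 2)" using assms by (intro power_mono) auto
  finally have "1 \<le> real n ^ (m + 2) / 2 ^ l" by simp
  then show ?thesis by (rule order_trans[OF measure_pmf.prob_le_1])
next
  case False
  then obtain j where l: "l = Suc (Suc j)" by (metis add_2_eq_Suc le_Suc_ex not_less)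
  define c where "c = (real 2 / (real n - 1)) ^ (m + 1)"
  have c: "c > 0" using assms by (simp add: c_def)
  define f where "f G = (excess m 2 j n G + real m * (real n - 2)) / (real m * 2 ^ j * c)" for G
  have f: "f G = real (total_weight G 2 j) / (real m * 2 ^ j)" for G
    unfolding f_def excess_def c_def[symmetric] using c by simp
  note fin = finite_pref_attach[OF assms(1), of n]
  have "measure_pmf.prob (pref_attach m n) {G. outside_first_layers G l \<noteq> {}}
      \<le> measure_pmf.expectation (pref_attach m n) f"
  proof (rule prob_le_expectation[OF fin])
    fix G assume G: "G \<in> set_pmf (pref_attach m n)" and "G \<in> {G. outside_first_layers G l \<noteq> {}}"
    then obtain v where v: "v \<in> outside_first_layers G (Suc (Suc j))" by (auto simp: l)
    note A = assms(1) _ G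
    obtain u where u: "(u, v) \<in># arcs (DAG G)" "u \<in> outside_first_layers G (Suc j)"
      using outside_first_layers_Suc[OF A v] assms by auto
    obtain x where x: "(x, u) \<in># arcs (DAG G)" "x \<in> outside_first_layers G j"
      using outside_first_layers_Suc[OF A u(2)] assms by auto
    have "x > 2" using arcs_bounds[OF A u(1)] arcs_bounds[OF A x(1)] assms by auto
    moreover have "finite (outside_first_layers G j)"
      using pref_attach_invariant(1)[OF A] assms by (auto simp: outside_first_layers_def)
    ultimately have "1 \<le> card (outside_first_layers G j \<inter> {2<..})"
      using x(2) by (auto simp: Suc_le_eq card_gt_0_iff)
    then have "m * 2 ^ j * 1 \<le> m * 2 ^ j * card (outside_first_layers G j \<inter> {2<..})"
      by (rule mult_left_mono) simp
    also have "\<dots> \<le> total_weight G 2 j"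
      using card_outside_le_total_weight[OF A] assms by simp
    finally have "real (m * 2 ^ j * 1) \<le> real (total_weight G 2 j)" by (simp only: of_nat_le_iff)
    then have "real m * 2 ^ j \<le> real (total_weight G 2 j)" by simp
    then show "1 \<le> f G" using assms by (simp add: f)
  qed (simp add: f)
  also have "\<dots> = (measure_pmf.expectation (pref_attach m n) (excess m 2 j n) + real m * (real n - 2))
      / (real m * 2 ^ j * c)"
    unfolding f_def by (simp add: integrable_measure_pmf_finite[OF fin])
  also have "\<dots> \<le> (0 + real m * (real n - 2)) / (real m * 2 ^ j * c)"
    using expectation_excess_le[OF assms(1) _ assms(2)] c by (intro divide_right_mono add_right_mono) auto
  also have "\<dots> = (real n - 2) / 2 ^ j * ((real n - 1) / 2) ^ (m + 1)"
    using assms by (simp add: c_def power_divide field_simps)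
  also have "\<dots> \<le> real n / 2 ^ j * (real n / 2) ^ (m + 1)"
    using assms by (intro mult_mono divide_right_mono power_mono) auto
  also have "\<dots> = real n ^ (m + 2) / (2 ^ j * 2 ^ (m + 1))" by (simp add: power_divide)
  also have "\<dots> \<le> real n ^ (m + 2) / (2 ^ j * 2 ^ 2)"
    using assms by (intro divide_left_mono mult_left_mono power_increasing) auto
  finally show ?thesis by (simp add: l)
qed

text \<open>
  Markov's inequality for the square of the positive part of \<open>excess\<close>, with the threshold \<open>k\<close> about
  \<open>g * n / 2\<close>. At least \<open>g * n / 4\<close> of the vertices outside the first \<open>l\<close> layers exceed \<open>k\<close>, which by
  the last assumption pushes \<open>excess\<close> above \<open>m * n\<close>.
\<close>

lemma prob_many_deep_vertices_le:
  fixes g :: real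
  assumes "m \<ge> 1" "0 < g" "g \<le> 1" "g * real n \<ge> 4" "2 ^ l * (g / 2) ^ (m + 2) \<ge> 4"
  shows "measure_pmf.prob (pref_attach m n) {G. real (card (outside_first_layers G l)) > g * real n}
    \<le> (2 * real m + 1) ^ (2 * l + 2) / real n"
proof -
  define k where "k = nat \<lceil>g * real n / 2\<rceil>"
  have k: "g * real n / 2 \<le> real k" "real k < g * real n / 2 + 1"
    using assms by (auto simp: k_def) linarith+
  have gn: "g * real n \<le> real n" using assms by (simp add: mult_left_le_one_le)
  have k2: "2 \<le> k" "k \<le> n" using k gn assms(4) by linarith+
  define f where "f G = (max 0 (excess m k l n G))\<^sup>2 * (1 / (real m * real n)\<^sup>2)" for G
  note fin = finite_pref_attach[OF assms(1), of n]
  have "measure_pmf.prob (pref_attach m n) {G. real (card (outside_first_layers G l)) > g * real n}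
      \<le> measure_pmf.expectation (pref_attach m n) f"
  proof (rule prob_le_expectation[OF fin])
    fix G assume G: "G \<in> set_pmf (pref_attach m n)"
      and "G \<in> {G. real (card (outside_first_layers G l)) > g * real n}"
    then have large: "real (card (outside_first_layers G l)) > g * real n" by simp
    let ?O = "outside_first_layers G l"
    have n: "n \<ge> 1" using k2 by simp
    have "?O \<subseteq> {1..n}" using pref_attach_invariant(1)[OF assms(1) n G] by (auto simp: outside_first_layers_def)
    then have "?O \<subseteq> (?O \<inter> {k<..}) \<union> {1..k}" "finite ?O" by (auto intro: finite_subset)
    then have "card ?O \<le> card ((?O \<inter> {k<..}) \<union> {1..k})" by (intro card_mono) auto
    also have "\<dots> \<le> card (?O \<inter> {k<..}) + card {1..k}" by (rule card_Un_le)
    finally have "real (card ?O) \<le> real (card (?O \<inter> {k<..})) + real k" by simp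
    then have many: "g * real n / 4 \<le> real (card (?O \<inter> {k<..}))" using large k(2) assms(4) by linarith
    have "real m * 2 ^ l * (g * real n / 4) \<le> real m * 2 ^ l * real (card (?O \<inter> {k<..}))"
      using many by (rule mult_left_mono) simp
    also have "\<dots> = real (m * 2 ^ l * card (?O \<inter> {k<..}))" by simp
    also have "\<dots> \<le> real (total_weight G k l)"
      using card_outside_le_total_weight[OF assms(1) n G] of_nat_le_iff by blast
    finally have S: "real m * 2 ^ l * (g * real n / 4) \<le> real (total_weight G k l)" .
    have "g / 2 * (real n - 1) \<le> real k" using k(1) assms(2) by (simp add: algebra_simps)
    then have "g / 2 \<le> real k / (real n - 1)" using k2 by (simp add: field_simps)
    then have "(g / 2) ^ (m + 1) \<le> (real k / (real n - 1)) ^ (m + 1)" using assms(2) by (intro power_mono) auto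
    with S have "(g / 2) ^ (m + 1) * (real m * 2 ^ l * (g * real n / 4))
        \<le> (real k / (real n - 1)) ^ (m + 1) * real (total_weight G k l)"
      using assms(2) k2 by (intro mult_mono) auto
    moreover have "(g / 2) ^ (m + 1) * (real m * 2 ^ l * (g * real n / 4))
        = 2 ^ l * (g / 2) ^ (m + 2) * (real m * real n / 2)"
      by simp
    moreover have "2 ^ l * (g / 2) ^ (m + 2) * (real m * real n / 2) \<ge> 4 * (real m * real n / 2)"
      using assms(5) by (rule mult_right_mono) simp
    moreover have "real m * (real n - real k) \<le> real m * real n" by (simp add: mult_left_mono)
    ultimately have "real m * real n \<le> excess m k l n G" unfolding excess_def by linarith
    then have "(real m * real n)\<^sup>2 \<le> (max 0 (excess m k l n G))\<^sup>2" by (intro power_mono) auto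
    then show "1 \<le> f G" using assms(1) n by (simp add: f_def)
  qed (simp add: f_def)
  also have "\<dots> = measure_pmf.expectation (pref_attach m n) (\<lambda>G. (max 0 (excess m k l n G))\<^sup>2)
      * (1 / (real m * real n)\<^sup>2)"
    unfolding f_def by (rule integral_mult_left_zero)
  also have "\<dots> \<le> (real m * (2 * real m + 1) ^ (l + 1))\<^sup>2 * real n * (1 / (real m * real n)\<^sup>2)"
    by (intro mult_right_mono expectation_excess_square_le assms(1) k2) simp
  also have "\<dots> = (2 * real m + 1) ^ (2 * (l + 1)) / real n"
  proof -
    have "(real m * q)\<^sup>2 * real n * (1 / (real m * real n)\<^sup>2) = q\<^sup>2 / real n" for q
      using assms(1) k2 by (simp add: power2_eq_square)
    then show ?thesis unfolding power_even_eq .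
  qed
  finally show ?thesis by simp
qed

section \<open>Edge probabilities\<close>

lemma adjacent_attach:
  "adjacent (attach G (Suc n) ws) v w \<longleftrightarrow> adjacent G v w \<or> (\<exists>x\<in>set ws. {v, w} = {Suc n, x})"
  by (simp only: adjacent_def attach_def multigraph.sel set_mset_union Un_iff set_image_mset
      set_mset_mset image_iff)

lemma adjacent_attach_new:
  assumes "m \<ge> 1" "n \<ge> 1" "G \<in> set_pmf (pref_attach m n)" "w \<le> n"
  shows "adjacent (attach G (Suc n) ws) (Suc n) w \<longleftrightarrow> w \<in> set ws"
proof -
  have 1: "\<not> adjacent G (Suc n) w"
    using pref_attach_invariant(2)[OF assms(1-3)] by (fastforce simp: adjacent_def)
  have 2: "{Suc n, w} = {Suc n, x} \<longleftrightarrow> x = w" for x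
    using assms(4) by (metis Suc_n_not_le_n doubleton_eq_iff)
  show ?thesis unfolding adjacent_attach 2 using 1 by blast
qed

lemma adjacent_attach_old:
  assumes "w \<le> n" "v \<le> n"
  shows "adjacent (attach G (Suc n) ws) v w \<longleftrightarrow> adjacent G v w"
proof -
  have "{v, w} \<noteq> {Suc n, x}" for x using assms by (metis Suc_n_not_le_n doubleton_eq_iff)
  then show ?thesis by (simp only: adjacent_attach simp_thms bex_triv)
qed

text \<open>
  Later vertices create no edges between old ones.
\<close>

lemma prob_adjacent_eq:
  assumes "m \<ge> 1" "v \<ge> 1" "w \<le> v" "v \<le> n"
  shows "measure_pmf.prob (pref_attach m n) {G. adjacent G v w}
    = measure_pmf.prob (pref_attach m v) {G. adjacent G v w}"
  using assms(4)
proof (induction n rule: dec_induct)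
  case (step n)
  let ?I = "\<lambda>G. indicator {G. adjacent G v w} G :: real"
  have n: "n \<ge> 1" "w \<le> n" using assms step.hyps by linarith+
  have "?I (attach G (Suc n) ws) = ?I G" for G ws
    by (simp only: indicator_def mem_Collect_eq adjacent_attach_old[OF n(2) step.hyps(1)])
  then have "measure_pmf.expectation (pref_attach m (Suc n)) ?I = measure_pmf.expectation (pref_attach m n) ?I"
    unfolding expectation_pref_attach_Suc[OF assms(1) n(1)]
    by (simp only: measure_pmf.prob_space lebesgue_integral_const scaleR_one)
  then show ?case using step.IH by (simp only: prob_eq_expectation)
qed (rule refl)

lemma prob_adjacent_new:
  assumes "m \<ge> 1" "n \<ge> 1" "1 \<le> w" "w \<le> n"
  shows "measure_pmf.prob (pref_attach m (Suc n)) {G. adjacent G (Suc n) w}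
    = measure_pmf.expectation (pref_attach m n)
        (\<lambda>G. 1 - (1 - real (vdeg G w) / (real m * (2 * real n - 1))) ^ m)"
  unfolding prob_eq_expectation expectation_pref_attach_Suc[OF assms(1,2)]
proof (rule expectation_cong)
  fix G assume G: "G \<in> set_pmf (pref_attach m n)"
  let ?p = "replicate_pmf m (neighbor_pmf G)"
  have "measure_pmf.expectation ?p (\<lambda>ws. indicator {G. adjacent G (Suc n) w} (attach G (Suc n) ws))
      = measure_pmf.expectation ?p (\<lambda>ws. indicator (- {ws. w \<notin> set ws}) ws :: real)"
    using assms G by (intro expectation_cong) (auto simp: indicator_def adjacent_attach_new)
  also have "\<dots> = 1 - measure_pmf.prob ?p {ws. w \<notin> set ws}"
    using measure_pmf.prob_compl[of "{ws. w \<notin> set ws}" ?p] by (simp add: Compl_eq_Diff_UNIV)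
  also have "\<dots> = 1 - (1 - real (vdeg G w) / (real m * (2 * real n - 1))) ^ m"
    using assms prob_replicate_not_in[OF finite_neighbor_pmf[OF assms(1,2) G]]
    by (simp add: pmf_neighbor_pmf[OF assms(1,2) G] algebra_simps)
  finally show "measure_pmf.expectation ?p (\<lambda>ws. indicator {G. adjacent G (Suc n) w} (attach G (Suc n) ws))
      = 1 - (1 - real (vdeg G w) / (real m * (2 * real n - 1))) ^ m" .
qed

text \<open>
  The expected degree is multiplied by \<open>1 + 1 / (2 * t - 1)\<close> at time \<open>t\<close>. The constants in the square
  root are such that this factor is at most \<open>sqrt ((4 * t + 1) / (4 * t - 3))\<close>, which telescopes.
\<close>

lemma expectation_vdeg_le:
  assumes "m \<ge> 1" "1 \<le> w" "w \<le> n"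
  shows "measure_pmf.expectation (pref_attach m n) (\<lambda>G. real (vdeg G w))
    \<le> real m * sqrt ((4 * real n - 3) / (4 * real w - 3))"
proof -
  have "measure_pmf.expectation (pref_attach m n) (\<lambda>G. real (vdeg G w) / sqrt (4 * real n - 3))
     \<le> real m / sqrt (4 * real w - 3) + 0 * real (n - w)"
  proof (rule expectation_drift[OF assms])
    fix G assume "G \<in> set_pmf (pref_attach m w)"
    then show "real (vdeg G w) / sqrt (4 * real w - 3) \<le> real m / sqrt (4 * real w - 3)"
      using vdeg_ge(2) assms by simp
  next
    fix t G assume t: "w \<le> t" and G: "G \<in> set_pmf (pref_attach m t)"
    have t1: "t \<ge> 1" using t assms by simp
    let ?p = "replicate_pmf m (neighbor_pmf G)"
    have fin: "finite (set_pmf ?p)"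
      using assms t1 G by (intro finite_set_replicate_pmf finite_neighbor_pmf)
    have "measure_pmf.expectation ?p (\<lambda>ws. real (vdeg (attach G (Suc t) ws) w) / sqrt (4 * real (Suc t) - 3))
      = measure_pmf.expectation ?p (\<lambda>ws. (real (vdeg G w) + (\<Sum>x\<leftarrow>ws. indicator {w} x)) / sqrt (4 * real t + 1))"
    proof (intro expectation_cong)
      fix ws assume ws: "ws \<in> set_pmf ?p"
      have "real (count (mset ws) w) = (\<Sum>x\<leftarrow>ws. indicator {w} x)" by (induction ws) auto
      then show "real (vdeg (attach G (Suc t) ws) w) / sqrt (4 * real (Suc t) - 3)
         = (real (vdeg G w) + (\<Sum>x\<leftarrow>ws. indicator {w} x)) / sqrt (4 * real t + 1)"
        using vdeg_attach[OF pref_attach_invariant(2)[OF assms(1) t1 G] set_choices(1)[OF assms(1) t1 G ws]] t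
        by simp
    qed
    also have "\<dots> = (real (vdeg G w) + real m * pmf (neighbor_pmf G) w) / sqrt (4 * real t + 1)"
      using finite_neighbor_pmf[OF assms(1) t1 G]
      by (simp add: integrable_measure_pmf_finite[OF fin] expectation_replicate_sum measure_pmf_single)
    also have "\<dots> = real (vdeg G w) * ((1 + 1 / (2 * real t - 1)) / sqrt (4 * real t + 1))"
    proof -
      have "pmf (neighbor_pmf G) w = real (vdeg G w) / (real m * (2 * real t - 1))"
        using t assms by (simp add: pmf_neighbor_pmf[OF assms(1) t1 G] algebra_simps)
      then have "real m * pmf (neighbor_pmf G) w = real (vdeg G w) / (2 * real t - 1)"
        using assms(1) by simp
      then show ?thesis by (simp add: distrib_left)
    qed
    also have "\<dots> \<le> real (vdeg G w) * (1 / sqrt (4 * real t - 3))"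
    proof (intro mult_left_mono)
      define x where "x = real t"
      have x: "x \<ge> 1" using t1 by (simp add: x_def)
      have "(2 * x)\<^sup>2 * (4 * x - 3) \<le> (2 * x - 1)\<^sup>2 * (4 * x + 1)"
        by (simp add: power2_eq_square algebra_simps)
      then have "sqrt ((2 * x)\<^sup>2 * (4 * x - 3)) \<le> sqrt ((2 * x - 1)\<^sup>2 * (4 * x + 1))"
        by (rule real_sqrt_le_mono)
      then have "2 * x * sqrt (4 * x - 3) \<le> (2 * x - 1) * sqrt (4 * x + 1)"
        using x by (simp add: real_sqrt_mult)
      moreover have "1 + 1 / (2 * x - 1) = 2 * x / (2 * x - 1)" using x by (simp add: field_simps)
      ultimately show "(1 + 1 / (2 * real t - 1)) / sqrt (4 * real t + 1) \<le> 1 / sqrt (4 * real t - 3)"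
        using x unfolding x_def[symmetric] by (simp add: divide_simps)
    qed simp
    finally show "measure_pmf.expectation ?p (\<lambda>ws. real (vdeg (attach G (Suc t) ws) w) / sqrt (4 * real (Suc t) - 3))
      \<le> real (vdeg G w) / sqrt (4 * real t - 3) + 0" by simp
  qed
  then show ?thesis using assms by (simp add: real_sqrt_divide field_simps)
qed

text \<open>
  Given the graph at time \<open>t\<close>, the union bound over the \<open>m\<close> choices of the vertex \<open>t + 1\<close> makes \<open>w\<close>
  adjacent to it with probability at most \<open>deg w / (2 * t - 1)\<close>.
\<close>

lemma edge_prob_bound_2:
  assumes "m \<ge> 1"
  shows "edge_prob_bound m 2"
  unfolding edge_prob_bound_def
proof (intro allI impI)
  fix n v w :: nat assume vw: "1 \<le> w \<and> w < v \<and> v \<le> n"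
  then obtain t where v: "v = Suc t" by (cases v) auto
  have t: "1 \<le> w" "w \<le> t" "t \<ge> 1" using vw v by auto
  note fin = finite_pref_attach[OF assms, of t]
  have "measure_pmf.prob (pref_attach m n) {G. adjacent G v w}
      = measure_pmf.expectation (pref_attach m t)
          (\<lambda>G. 1 - (1 - real (vdeg G w) / (real m * (2 * real t - 1))) ^ m)"
    using prob_adjacent_eq[OF assms, of v w n] prob_adjacent_new[OF assms t(3,1,2)] vw v by simp
  also have "\<dots> \<le> measure_pmf.expectation (pref_attach m t) (\<lambda>G. real (vdeg G w) / (2 * real t - 1))"
  proof (rule expectation_mono_finite[OF fin])
    fix G assume G: "G \<in> set_pmf (pref_attach m t)"
    let ?q = "real (vdeg G w) / (real m * (2 * real t - 1))"
    have "?q = pmf (neighbor_pmf G) w"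
      using t by (simp add: pmf_neighbor_pmf[OF assms t(3) G] algebra_simps)
    then have "1 + real m * (- ?q) \<le> (1 + (- ?q)) ^ m"
      by (intro Bernoulli_inequality) (simp add: pmf_le_1)
    then show "1 - (1 - ?q) ^ m \<le> real (vdeg G w) / (2 * real t - 1)"
      using assms by simp
  qed
  also have "\<dots> \<le> real m * sqrt ((4 * real t - 3) / (4 * real w - 3)) / (2 * real t - 1)"
    using expectation_vdeg_le[OF assms t(1,2)] t by (simp add: divide_right_mono)
  also have "\<dots> \<le> 2 * real m / sqrt (real v * real w)"
  proof -
    have frac: "a / b / d \<le> 2 / e" if "a * e \<le> 2 * d * b" "b > 0" "e > 0" "d > 0" for a b d e :: real
      using that by (simp add: divide_simps mult_ac)
    define x y where "x = real t" and "y = real w"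
    have xy: "x \<ge> 1" "y \<ge> 1" using t by (auto simp: x_def y_def)
    have q: "(4 * x - 3) * (x + 1) \<le> 4 * (2 * x - 1)\<^sup>2"
      \<comment> \<open>Twelve times the difference of the two sides exceeds this square.\<close>
      using zero_le_power2[of "12 * x - 17 / 2"] by (simp add: power2_eq_square algebra_simps)
    have "((4 * x - 3) * (x + 1)) * y \<le> (4 * (2 * x - 1)\<^sup>2) * (4 * y - 3)"
      by (rule mult_mono[OF q]) (use xy in auto)
    then have "sqrt ((4 * x - 3) * ((x + 1) * y)) \<le> sqrt ((2 * (2 * x - 1))\<^sup>2 * (4 * y - 3))"
      by (intro real_sqrt_le_mono) (simp add: power2_eq_square algebra_simps)
    then have "sqrt (4 * x - 3) * sqrt ((x + 1) * y) \<le> 2 * (2 * x - 1) * sqrt (4 * y - 3)"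
      using xy by (simp add: real_sqrt_mult)
    moreover have "sqrt (4 * y - 3) > 0" "sqrt ((x + 1) * y) > 0" "2 * x - 1 > 0" using xy by auto
    ultimately have "sqrt (4 * x - 3) / sqrt (4 * y - 3) / (2 * x - 1) \<le> 2 / sqrt ((x + 1) * y)"
      by (rule frac)
    then have "sqrt ((4 * x - 3) / (4 * y - 3)) / (2 * x - 1) \<le> 2 / sqrt ((x + 1) * y)"
      by (simp add: real_sqrt_divide)
    then have "real m * (sqrt ((4 * x - 3) / (4 * y - 3)) / (2 * x - 1)) \<le> real m * (2 / sqrt ((x + 1) * y))"
      by (rule mult_left_mono) simp
    then show ?thesis by (simp add: v x_def y_def mult_ac add.commute)
  qed
  finally show "measure_pmf.prob (pref_attach m n) {G. adjacent G v w} \<le> 2 * real m / sqrt (real v * real w)" .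
qed

text \<open>
  The vertex \<open>t\<close> has degree exactly \<open>m\<close> when \<open>t + 1\<close> arrives, so it is chosen with the known
  probability \<open>p = 1 / (2 * t - 1)\<close> each time. Letting \<open>t\<close> grow would give \<open>1 / 2\<close>; taking \<open>t > 5 * m\<close>
  keeps \<open>m * p\<close> below \<open>1 / 5\<close>, which leaves \<open>5 / 12\<close>.
\<close>

lemma edge_prob_bound_ge:
  assumes "m \<ge> 1" "edge_prob_bound m C"
  shows "C \<ge> 5 / 12"
proof -
  define t where "t = 5 * m + 1"
  define p where "p = 1 / (2 * real t - 1)"
  have t: "t \<ge> 1" by (simp add: t_def)
  have p: "0 < p" "p \<le> 1" "real m * p \<le> 1 / 5" using assms by (auto simp: p_def t_def field_simps)
  have "measure_pmf.prob (pref_attach m (Suc t)) {G. adjacent G (Suc t) t}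
      = measure_pmf.expectation (pref_attach m t) (\<lambda>G. 1 - (1 - p) ^ m)"
    unfolding prob_adjacent_new[OF assms(1) t t order_refl]
    using vdeg_ge(2)[OF assms(1) t] assms(1) by (intro expectation_cong) (simp add: p_def)
  then have "measure_pmf.prob (pref_attach m (Suc t)) {G. adjacent G (Suc t) t} = 1 - (1 - p) ^ m"
    by simp
  then have "1 - (1 - p) ^ m \<le> C * real m / sqrt (real (Suc t) * real t)"
    using assms(2) t unfolding edge_prob_bound_def by (metis lessI order_refl)
  moreover have "1 - (1 - p) ^ m \<ge> 5 / 6 * (real m * p)"
  proof -
    have "(1 - p) ^ m * (1 + real m * p) \<le> (1 - p) ^ m * (1 + p) ^ m"
      using p Bernoulli_inequality[of p m] by (intro mult_left_mono) auto
    also have "\<dots> = (1 - p\<^sup>2) ^ m"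
      by (simp add: power_mult_distrib[symmetric] power2_eq_square algebra_simps)
    also have "\<dots> \<le> 1" using p by (intro power_le_one) (auto simp: power_le_one)
    finally have "(1 - p) ^ m * (1 + real m * p) \<le> 1" .
    moreover have "1 \<le> (1 - 5 / 6 * (real m * p)) * (1 + real m * p)"
    proof -
      have "0 \<le> (real m * p) * (1 / 5 - real m * p)" using p by simp
      then show ?thesis by (simp add: algebra_simps)
    qed
    ultimately have "(1 - p) ^ m * (1 + real m * p) \<le> (1 - 5 / 6 * (real m * p)) * (1 + real m * p)" by linarith
    moreover have "1 + real m * p > 0" using p by (simp add: add_pos_nonneg)
    ultimately show ?thesis by (simp only: mult_le_cancel_right_pos)
  qed
  ultimately have *: "5 / 6 * (real m * p) \<le> C * real m / sqrt (real (Suc t) * real t)" by linarith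
  define r where "r = sqrt (real (Suc t) * real t)"
  have r: "real t \<le> r" "r > 0"
    unfolding r_def using t by (auto intro!: real_le_rsqrt simp: power2_eq_square mult_right_mono)
  have "5 / 6 * (real m * p) * real t \<le> 5 / 6 * (real m * p) * r"
    using r(1) p(1) by (intro mult_left_mono) auto
  also have "\<dots> \<le> C * real m"
    using *[folded r_def] r(2) by (simp only: pos_le_divide_eq)
  finally have "5 / 6 * (real m * p) * real t \<le> C * real m" .
  then have "5 / 6 * (p * real t) \<le> C" using assms(1) by simp
  moreover have "1 / 2 \<le> p * real t" using t by (simp add: p_def field_simps)
  ultimately show ?thesis by linarith
qed

section \<open>Choosing the number of layers\<close>

lemma prob_mono_on_support:
  assumes "\<And>x. x \<in> set_pmf p \<Longrightarrow> x \<in> A \<Longrightarrow> x \<in> B"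
  shows "measure_pmf.prob p A \<le> measure_pmf.prob p B"
  using assms by (intro measure_pmf.finite_measure_mono_AE) (auto simp: AE_measure_pmf_iff)

lemma two_times_le_two_powr_power4:
  fixes y :: real
  assumes "y \<ge> 1"
  shows "2 * y \<le> 2 powr (y ^ 4)"
proof -
  have "ln y \<le> y - 1" using assms by (intro ln_le_minus_one) simp
  also have "\<dots> \<le> ln 2 * (4 * (y - 1))"
    using mult_right_mono[of "1 / 4" "ln (2 :: real)" "4 * (y - 1)"] ln2_ge_two_thirds assms by simp
  also have "\<dots> \<le> ln 2 * (y ^ 4 - 1)"
    using Bernoulli_inequality[of "y - 1" 4] assms by (intro mult_left_mono) auto
  finally have "ln (2 * y) \<le> ln 2 * y ^ 4" using assms by (simp add: ln_mult algebra_simps)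
  then have "exp (ln (2 * y)) \<le> exp (ln 2 * y ^ 4)" by (simp only: exp_le_cancel_iff)
  then show ?thesis using assms by (simp add: powr_def mult.commute)
qed

text \<open>
  With \<open>y = 1 / g\<close>, the exponent \<open>5 * m * y ^ 4\<close> is split: \<open>3 * m * y ^ 4\<close> pays for
  \<open>(2 * y) ^ (m + 2)\<close>, as \<open>m + 2 \<le> 3 * m\<close>, and \<open>2 * m * y ^ 4\<close> for the factor 4.
\<close>

lemma two_power_layers_ge:
  fixes g :: real
  assumes "m \<ge> 1" "0 < g" "g \<le> 1" "5 * real m / g ^ 4 \<le> real l"
  shows "2 ^ l * (g / 2) ^ (m + 2) \<ge> 4"
proof -
  define y where "y = 1 / g"
  have y: "y \<ge> 1" "y ^ 4 \<ge> 1" using assms by (auto simp: y_def power_divide power_le_one)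
  have "4 * (2 * y) ^ (m + 2) \<le> 4 * (2 * y) ^ (3 * m)"
    using assms y by (intro mult_left_mono power_increasing) auto
  also have "\<dots> \<le> 2 powr (2 * real m * y ^ 4) * (2 powr (y ^ 4)) ^ (3 * m)"
  proof (intro mult_mono power_mono two_times_le_two_powr_power4)
    have "1 * 1 \<le> real m * y ^ 4" using assms y by (intro mult_mono) auto
    then have "2 powr 2 \<le> 2 powr (2 * real m * y ^ 4)" by (intro powr_mono) auto
    then show "4 \<le> 2 powr (2 * real m * y ^ 4)" by simp
  qed (use y in auto)
  also have "\<dots> = 2 powr (5 * real m * y ^ 4)"
    by (simp add: powr_realpow[symmetric] powr_powr powr_add[symmetric] algebra_simps)
  also have "\<dots> \<le> 2 powr real l"
    using assms(4) by (intro powr_mono) (auto simp: y_def power_divide)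
  also have "\<dots> = 2 ^ l" by (simp add: powr_realpow)
  finally have "4 * (2 * y) ^ (m + 2) * (g / 2) ^ (m + 2) \<le> 2 ^ l * (g / 2) ^ (m + 2)"
    using assms(2) by (intro mult_right_mono) auto
  moreover have "(2 * y) ^ (m + 2) * (g / 2) ^ (m + 2) = 1"
    using assms(2) unfolding power_mult_distrib[symmetric] by (simp add: y_def)
  ultimately show ?thesis by (simp only: mult.assoc)
qed

text \<open>
  If \<open>l\<close> is at least \<open>(m + 3) * log 2 n\<close>, the first-moment bound leaves \<open>1 / n\<close>. Otherwise
  \<open>5 * m / g ^ 4 \<le> l\<close> bounds \<open>g\<close> below by \<open>1 / log 2 n\<close>, and the second-moment bound is applied with
  \<open>min l h\<close> layers, since its error grows exponentially with the number of layers.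
\<close>

lemma prob_few_deep_vertices_fails_le:
  fixes g :: real
  assumes "m \<ge> 1" "n \<ge> 2" "0 < g" "5 * real m / g ^ 4 \<le> real l"
    and n: "1 \<le> log 2 n" "4 \<le> n / log 2 n" "4 * (2 * log 2 n) ^ (m + 2) \<le> 2 ^ h"
  shows "measure_pmf.prob (pref_attach m n) {G. \<not> real (card (outside_first_layers G l)) \<le> g * real n}
    \<le> 1 / real n + (2 * real m + 1) ^ (2 * h + 2) / real n"
proof -
  let ?B = "{G. \<not> real (card (outside_first_layers G l)) \<le> g * real n}"
  let ?L = "log 2 n"
  have sub: "outside_first_layers G j \<subseteq> {1..n}" if "G \<in> set_pmf (pref_attach m n)" for G j
    using pref_attach_invariant(1)[OF assms(1) _ that] assms(2) by (auto simp: outside_first_layers_def)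
  \<comment> \<open>For \<open>g \<ge> 1\<close> there are not enough vertices for the bound to fail.\<close>
  consider "g \<ge> 1" | "g < 1" "(real m + 3) * ?L \<le> real l" | "g < 1" "real l < (real m + 3) * ?L"
    by linarith
  then show ?thesis
  proof cases
    case 1
    have "measure_pmf.prob (pref_attach m n) ?B \<le> measure_pmf.prob (pref_attach m n) {}"
    proof (rule prob_mono_on_support)
      fix G assume "G \<in> set_pmf (pref_attach m n)" "G \<in> ?B"
      moreover have "real n \<le> g * real n" using mult_right_mono[OF 1, of "real n"] by simp
      ultimately show "G \<in> {}" using card_mono[OF _ sub[of G l]] by fastforce
    qed
    then show ?thesis using assms(2) by (simp add: order_trans[of _ 0])
  next
    case 2
    have "measure_pmf.prob (pref_attach m n) ?B
        \<le> measure_pmf.prob (pref_attach m n) {G. outside_first_layers G l \<noteq> {}}"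
      using assms(3) by (intro prob_mono_on_support) (auto simp: not_le mult_less_0_iff)
    also have "\<dots> \<le> real n ^ (m + 2) / 2 ^ l" by (rule prob_deep_vertex_le[OF assms(1,2)])
    also have "\<dots> \<le> real n ^ (m + 2) / real n ^ (m + 3)"
    proof (rule divide_left_mono)
      have "real n ^ (m + 3) = (2 powr ?L) ^ (m + 3)" using assms(2) by simp
      also have "\<dots> = 2 powr ((real m + 3) * ?L)"
        by (simp add: powr_realpow[symmetric] powr_powr algebra_simps del: powr_log_cancel)
      also have "\<dots> \<le> 2 powr real l" using 2 by (intro powr_mono) auto
      finally show "real n ^ (m + 3) \<le> 2 ^ l" by (simp add: powr_realpow)
    qed (use assms(2) in auto)
    also have "\<dots> = 1 / real n" using assms(2) by (simp add: power_add numeral_eq_Suc)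
    finally show ?thesis by (simp add: add_increasing2)
  next
    case 3
    have "5 * real m / g ^ 4 < (real m + 3) * ?L" using assms(4) 3 by linarith
    also have "\<dots> \<le> 5 * real m * ?L" using assms(1) n(1) by (intro mult_right_mono) auto
    finally have "1 < ?L * g ^ 4" using assms(1,3) by (simp add: field_simps)
    also have "\<dots> \<le> ?L * g" using power_decreasing[of 1 4 g] assms(3) 3 n(1) by (intro mult_left_mono) auto
    finally have g: "1 / ?L \<le> g" using n(1) by (simp add: field_simps)
    define j where "j = min l h"
    have "2 ^ h * (g / 2) ^ (m + 2) \<ge> 4"
    proof -
      have "4 = 4 * (2 * ?L) ^ (m + 2) * (1 / ?L / 2) ^ (m + 2)"
        using n(1) by (simp add: power_divide power_mult_distrib)
      also have "\<dots> \<le> 2 ^ h * (g / 2) ^ (m + 2)"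
        using n(1,3) g by (intro mult_mono power_mono divide_right_mono) auto
      finally show ?thesis .
    qed
    then have enough: "2 ^ j * (g / 2) ^ (m + 2) \<ge> 4"
      using two_power_layers_ge[OF assms(1,3) _ assms(4)] 3 by (simp add: j_def min_def)
    have "real n / ?L \<le> g * real n" using g by (simp add: mult_right_mono[of "1 / ?L" g "real n", simplified])
    then have gn: "g * real n \<ge> 4" using n(2) by linarith
    have "measure_pmf.prob (pref_attach m n) ?B
        \<le> measure_pmf.prob (pref_attach m n) {G. real (card (outside_first_layers G j)) > g * real n}"
    proof (rule prob_mono_on_support)
      fix G assume G: "G \<in> set_pmf (pref_attach m n)" "G \<in> ?B"
      have "card (outside_first_layers G l) \<le> card (outside_first_layers G j)"
        using finite_subset[OF sub[OF G(1)]] by (intro card_mono outside_first_layers_antimono) (auto simp: j_def)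
      then show "G \<in> {G. real (card (outside_first_layers G j)) > g * real n}" using G(2) by simp
    qed
    also have "\<dots> \<le> (2 * real m + 1) ^ (2 * j + 2) / real n"
      using 3 gn enough by (intro prob_many_deep_vertices_le assms) auto
    also have "\<dots> \<le> (2 * real m + 1) ^ (2 * h + 2) / real n"
      by (intro divide_right_mono power_increasing) (auto simp: j_def)
    finally show ?thesis by (simp add: add_increasing)
  qed
qed

text \<open>
  With \<open>h = \<lfloor>sqrt (log 2 n)\<rfloor>\<close>, the power \<open>2 ^ h\<close> outgrows every power of \<open>log 2 n\<close>, while
  \<open>(2 * m + 1) ^ (2 * h + 2)\<close> is still smaller than every positive power of \<open>n\<close>.
\<close>

lemma whp_few_deep_vertices:
  fixes \<gamma> :: "nat \<Rightarrow> real" and l :: "nat \<Rightarrow> nat"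
  assumes "m \<ge> 1" "\<And>n. \<gamma> n > 0" "\<And>n. 5 * real m / \<gamma> n ^ 4 \<le> real (l n)"
  shows "whp (pref_attach m) (\<lambda>n G. real (card (outside_first_layers G (l n))) \<le> \<gamma> n * real n)"
proof -
  let ?P = "\<lambda>n G. real (card (outside_first_layers G (l n))) \<le> \<gamma> n * real n"
  define h where "h n = nat \<lfloor>sqrt (log 2 (real n))\<rfloor>" for n :: nat
  define c where "c = 2 * real m + 1"
  have c: "c > 1" using assms(1) by (simp add: c_def)
  define e where "e n = 1 / real n + c powr (2 * sqrt (log 2 (real n)) + 2) / real n" for n :: nat
  have e: "e \<longlonglongrightarrow> 0" unfolding e_def using c by real_asymp
  have "filterlim (\<lambda>n::nat. log 2 (real n)) at_top sequentially" by real_asymp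
  moreover have "\<forall>\<^sub>F x::real in at_top. 2 powr (sqrt x - 1) \<ge> 4 * (2 * x) powr (real m + 2)"
    by real_asymp
  ultimately have "\<forall>\<^sub>F n::nat in sequentially. 2 powr (sqrt (log 2 n) - 1) \<ge> 4 * (2 * log 2 n) powr (real m + 2)"
    by (rule eventually_compose_filterlim[rotated])
  moreover have "\<forall>\<^sub>F n::nat in sequentially. real n / log 2 n \<ge> 4" "\<forall>\<^sub>F n::nat in sequentially. log 2 n \<ge> 1"
    by real_asymp+
  ultimately have low: "\<forall>\<^sub>F n in sequentially. 1 - e n \<le> measure_pmf.prob (pref_attach m n) {G. ?P n G}"
    using eventually_ge_at_top[of 2]
  proof eventually_elim
    case (elim n)
    have h: "real (h n) \<le> sqrt (log 2 n)" "sqrt (log 2 n) - 1 \<le> real (h n)"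
      using elim(3) unfolding h_def by auto
    have "(2 * log 2 n) ^ (m + 2) = (2 * log 2 n) powr real (m + 2)"
      using elim(3) by (intro powr_realpow[symmetric]) simp
    then have "4 * (2 * log 2 n) ^ (m + 2) = 4 * (2 * log 2 n) powr (real m + 2)"
      by (simp only: of_nat_add of_nat_numeral)
    also have "\<dots> \<le> 2 powr (sqrt (log 2 n) - 1)" by (rule elim(1))
    also have "\<dots> \<le> 2 powr real (h n)" using h(2) by (intro powr_mono) auto
    also have "\<dots> = 2 ^ h n" by (simp add: powr_realpow)
    finally have large: "4 * (2 * log 2 n) ^ (m + 2) \<le> 2 ^ h n" .
    have "measure_pmf.prob (pref_attach m n) (- {G. ?P n G}) \<le> 1 / real n + c ^ (2 * h n + 2) / real n"
      using prob_few_deep_vertices_fails_le[OF assms(1) elim(4) assms(2,3) elim(3,2) large]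
      by (simp add: c_def Collect_neg_eq)
    also have "c ^ (2 * h n + 2) = c powr (real (2 * h n + 2))" using c by (subst powr_realpow) auto
    also have "\<dots> \<le> c powr (2 * sqrt (log 2 n) + 2)" using h(1) c by (intro powr_mono) auto
    finally have "measure_pmf.prob (pref_attach m n) (- {G. ?P n G}) \<le> e n"
      by (simp add: e_def divide_right_mono)
    then show ?case
      using measure_pmf.prob_compl[of "{G. ?P n G}" "pref_attach m n"] by (simp add: Compl_eq_Diff_UNIV)
  qed
  have lim: "(\<lambda>n. 1 - e n) \<longlonglongrightarrow> 1" using tendsto_diff[OF tendsto_const e, of 1] by simp
  show ?thesis
    unfolding whp_def by (rule tendsto_sandwich[OF low _ lim tendsto_const]) simp
qed

theorem proposition1:
  fixes m :: nat
  assumes "m \<ge> 1"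
  shows
    "(\<exists>l :: real \<Rightarrow> nat. \<forall>\<gamma> :: nat \<Rightarrow> real. (\<forall>n. \<gamma> n > 0) \<longrightarrow>
        whp (pref_attach m)
          (\<lambda>n G. real (card (outside_first_layers G (l (\<gamma> n)))) \<le> \<gamma> n * real n))
     \<and> (\<exists>C > 0. edge_prob_bound m C)
     \<and> (\<forall>C > 0. edge_prob_bound m C \<longrightarrow>
          (\<forall>(\<gamma> :: nat \<Rightarrow> real) (l :: nat \<Rightarrow> nat).
             (\<forall>n. \<gamma> n > 0 \<and> real (l n) \<ge> 12 * C * real m / \<gamma> n ^ 4) \<longrightarrow>
             whp (pref_attach m)
               (\<lambda>n G. real (card (outside_first_layers G (l n))) \<le> \<gamma> n * real n)))"
proof (intro conjI allI impI)
  show "\<exists>l :: real \<Rightarrow> nat. \<forall>\<gamma> :: nat \<Rightarrow> real. (\<forall>n. \<gamma> n > 0) \<longrightarrow>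
        whp (pref_attach m)
          (\<lambda>n G. real (card (outside_first_layers G (l (\<gamma> n)))) \<le> \<gamma> n * real n)"
    by (intro exI[of _ "\<lambda>g. nat \<lceil>5 * real m / g ^ 4\<rceil>"] allI impI whp_few_deep_vertices assms)
       (auto simp: real_nat_ceiling_ge)
  show "\<exists>C > 0. edge_prob_bound m C"
    using edge_prob_bound_2[OF assms] by (intro exI[of _ 2]) simp
next
  fix C :: real and \<gamma> :: "nat \<Rightarrow> real" and l :: "nat \<Rightarrow> nat"
  assume C: "edge_prob_bound m C"
    and l: "\<forall>n. \<gamma> n > 0 \<and> real (l n) \<ge> 12 * C * real m / \<gamma> n ^ 4"
  show "whp (pref_attach m) (\<lambda>n G. real (card (outside_first_layers G (l n))) \<le> \<gamma> n * real n)"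
  proof (rule whp_few_deep_vertices[OF assms])
    fix n
    have "5 * real m / \<gamma> n ^ 4 \<le> 12 * C * real m / \<gamma> n ^ 4"
      using edge_prob_bound_ge[OF assms C] by (intro divide_right_mono mult_right_mono) auto
    then show "5 * real m / \<gamma> n ^ 4 \<le> real (l n)" using l order_trans by blast
  qed (use l in simp)
qed

end
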